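(* For every $p\in(1,2]$ there exist a constant $c_p\in(0,2)$ and a sequence $\eta_n\to0$ (both depending only on $p$) such that the following holds. For every $n\in\mathbb{N}$, every $\mathbf{k}=(k_1,\dots,k_{m+1})$ with integers $0=k_1<k_2<\cdots<k_{m+1}=n$, every bounded measurable $S\subseteq\mathbb{R}^n$ of positive volume, and every $\lambda\ge n^{-1}c_p^{-n}$, $$\alpha_{S}(\lambda)\ \ge\ (1+\eta_n)\,\frac{\log(2/c_p)\cdot n}{2^n}.$$
   Context: $\log$ is the natural logarithm. For $\mathbf{x}\in\mathbb{R}^n$ put $\mathbf{x}_j=(x_{k_j+1},\dots,x_{k_{j+1}})$, $\|\mathbf{x}\|_{p,\mathbf{k},n}=(\sum_{j=1}^m\|\mathbf{x}_j\|_2^p)^{1/p}$ ($\|\cdot\|_2$ Euclidean norm), $d(\mathbf{x},\mathbf{y})=\|\mathbf{y}-\mathbf{x}\|_{p,\mathbf{k},n}$, $B^n_{p,\mathbf{k}}(\mathbf{x},r)=\{\mathbf{y}:d(\mathbf{x},\mathbf{y})\le r\}$, and let $r_n=r_{p,\mathbf{k},n}$ be the radius with $\mathrm{vol}(B^n_{p,\mathbf{k}}(\mathbf 0,r_n))=1$. Hard superball model: for bounded measurable $S\subseteq\mathbb{R}^n$ and integer $t\ge1$ let $\hat Z_S(t)=\frac1{t!}\int_{S^t}\mathbf 1[d(\mathbf{x}_i,\mathbf{x}_j)\ge2r_n\ \forall i\ne j]\,d\mathbf{x}_1\cdots d\mathbf{x}_t$, $\hat Z_S(0)=1$, and $Z_S(\lambda)=\sum_{t\ge0}\lambda^t\hat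 Z_S(t)$. The (grand canonical) hard superball model on $S$ at fugacity $\lambda>0$ is the random finite set $X\subseteq S$ obtained by choosing $|X|=t$ with probability $\lambda^t\hat Z_S(t)/Z_S(\lambda)$ and then choosing $X$ uniformly (with respect to Lebesgue measure) among unordered $t$-subsets of $S$ with pairwise distances $d\ge2r_n$. For $S$ of positive volume, $\alpha_S(\lambda)=\mathbb{E}|X|/\mathrm{vol}(S)$ is the expected packing density. *)

theory Defs
  imports "HOL-Analysis.Analysis"
begin

text \<open>Points of R^n are functions nat => real; only coordinates 0..n-1 matter
 (0-indexed: paper coordinate i corresponds to index i-1).
 Lebesgue measure on R^n: completion of the n-fold product of lborel.\<close>

definition lebn :: "nat \<Rightarrow> (nat \<Rightarrow> real) measure" where
  "lebn n = completion (Pi\<^sub>M {..<n} (\<lambda>_. lborel))"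

text \<open>Block vector k: k 0 = 0 < k 1 < ... < k m = n (paper's k_1,...,k_{m+1}).\<close>
definition valid_blocks :: "nat \<Rightarrow> nat \<Rightarrow> (nat \<Rightarrow> nat) \<Rightarrow> bool" where
  "valid_blocks n m k \<longleftrightarrow> 0 < m \<and> k 0 = 0 \<and> k m = n \<and> (\<forall>j<m. k j < k (Suc j))"

definition blocknorm :: "real \<Rightarrow> nat \<Rightarrow> (nat \<Rightarrow> nat) \<Rightarrow> (nat \<Rightarrow> real) \<Rightarrow> real" where
  "blocknorm p m k x = (\<Sum>j<m. (sqrt (\<Sum>i\<in>{k j..<k (Suc j)}. (x i)^2)) powr p) powr (1/p)"

definition sdist :: "real \<Rightarrow> nat \<Rightarrow> (nat \<Rightarrow> nat) \<Rightarrow> (nat \<Rightarrow> real) \<Rightarrow> (nat \<Rightarrow> real) \<Rightarrow> real" where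
  "sdist p m k x y = blocknorm p m k (\<lambda>i. y i - x i)"

definition superball :: "real \<Rightarrow> nat \<Rightarrow> (nat \<Rightarrow> nat) \<Rightarrow> nat \<Rightarrow> (nat \<Rightarrow> real) \<Rightarrow> real \<Rightarrow> (nat \<Rightarrow> real) set" where
  "superball p m k n x r = {y \<in> PiE {..<n} (\<lambda>_. UNIV). sdist p m k x y \<le> r}"

definition rad :: "real \<Rightarrow> nat \<Rightarrow> (nat \<Rightarrow> nat) \<Rightarrow> nat \<Rightarrow> real" where
  "rad p m k n = (THE r. 0 < r \<and> emeasure (lebn n) (superball p m k n (\<lambda>_. 0) r) = 1)"

definition Zhat :: "real \<Rightarrow> nat \<Rightarrow> (nat \<Rightarrow> nat) \<Rightarrow> nat \<Rightarrow> (nat \<Rightarrow> real) set \<Rightarrow> nat \<Rightarrow> real" where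
  "Zhat p m k n S t = (if t = 0 then 1 else
     measure (completion (Pi\<^sub>M {..<t} (\<lambda>_. lebn n)))
       {xs \<in> PiE {..<t} (\<lambda>_. S). \<forall>i<t. \<forall>j<t. i \<noteq> j \<longrightarrow> sdist p m k (xs i) (xs j) \<ge> 2 * rad p m k n}
     / fact t)"

definition Zpart :: "real \<Rightarrow> nat \<Rightarrow> (nat \<Rightarrow> nat) \<Rightarrow> nat \<Rightarrow> (nat \<Rightarrow> real) set \<Rightarrow> real \<Rightarrow> real" where
  "Zpart p m k n S lam = (\<Sum>t. lam ^ t * Zhat p m k n S t)"

text \<open>Expected packing density: E|X| / vol S, where P(|X| = t) = lam^t Zhat(t) / Z(lam).\<close>
definition alpha :: "real \<Rightarrow> nat \<Rightarrow> (nat \<Rightarrow> nat) \<Rightarrow> nat \<Rightarrow> (nat \<Rightarrow> real) set \<Rightarrow> real \<Rightarrow> real" where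
  "alpha p m k n S lam =
     (\<Sum>t. real t * (lam ^ t * Zhat p m k n S t / Zpart p m k n S lam)) / measure (lebn n) S"

end

theory Submission
  imports Defs "HOL-Real_Asymp.Real_Asymp"
begin

text \<open>
  Let \<open>Z\<close> be the grand canonical partition function. Given the part of a random configuration outside the
  excluded ball of a point \<open>v\<close>, the part inside is a hard-core gas on a random set \<open>T\<close>. The point \<open>v\<close> is
  uncovered with probability \<open>E (1 / Z T) \<ge> E (exp (- \<lambda> |T|))\<close>, which bounds the density from below if
  \<open>|T|\<close> is small. If \<open>|T|\<close> is large there are many points inside: submultiplicativity gives
  \<open>Z (T - B x) / Z T \<ge> exp (- \<lambda> |T \<inter> B x|)\<close>, and \<open>|T \<inter> B x|\<close> is on average at most twice the
  volume \<open>c^n\<close> of a lens. Both exponentials are replaced by tangent lines, which makes the trade-off linear.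

  Uniform convexity of the block norm puts the lens into a ball of radius \<open>c * rad\<close> with \<open>c < 2\<close>.
  It follows blockwise from the parallelogram law and the strong convexity of \<open>t powr p\<close> on \<open>{0..1}\<close>.
\<close>

section \<open>Repulsive gases\<close>

text \<open>The density enters twice. It is \<open>lam\<close> times the uncovered probability
  averaged over the region, and by double counting the mean number of points in the excluded ball of
  an averaged point is at most \<open>2 ^ n\<close> times the density. So, with
  \<open>c = 2 * lens_ratio p\<close> and \<open>\<kappa> = 2 * lam * c ^ n\<close>, every real
  \<open>z\<close> gives \<open>exp (- z) * (1 + z) * lam \<le> alpha * (1 + exp (\<kappa> - z) *
  lam * 2 ^ n)\<close>. At \<open>lam = 1 / (n * c ^ n)\<close> the overlap cost
  \<open>\<kappa>\<close> is only \<open>2 / n\<close>, and a \<open>z\<close> slightly below the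
  logarithm of \<open>lam * 2 ^ n\<close>, hence about \<open>n * ln (2 / c)\<close>, makes the
  second summand dominate, so the density is at least about \<open>z / 2 ^ n\<close>. Larger
  fugacities follow because the density increases with the fugacity.

  Random sets never occur as such. A region becomes an activity function, placing a point
  \<open>x\<close> multiplies the activity by \<open>e x\<close>, and every probability stays
  multiplied by the partition function. Sums and integrals live in \<open>ennreal\<close>, so they
  can be interchanged without integrability conditions, and the negative term of a tangent line is
  moved to the other side.\<close>

lemma suminf_ennreal_diagonal:
  fixes a :: "nat \<Rightarrow> nat \<Rightarrow> ennreal"
  shows "(\<Sum>t. \<Sum>j\<le>t. a j (t - j)) = (\<Sum>j. \<Sum>l. a j l)"
proof -
  interpret P: pair_sigma_finite "count_space (UNIV :: nat set)" "count_space (UNIV :: nat set)"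
    by (intro pair_sigma_finite.intro sigma_finite_measure_count_space)
  let ?b = "\<lambda>t j. if j \<le> t then a j (t - j) else 0"
  have "(\<Sum>t. \<Sum>j\<le>t. a j (t - j)) = (\<Sum>t. \<Sum>j. ?b t j)"
  proof (rule suminf_cong)
    fix t
    show "(\<Sum>j\<le>t. a j (t - j)) = (\<Sum>j. ?b t j)"
      by (subst suminf_finite[of "{..t}"]) auto
  qed
  also have "\<dots> = (\<Sum>j. \<Sum>t. ?b t j)"
    unfolding nn_integral_count_space_nat[symmetric]
    by (rule P.Fubini'[of "\<lambda>j t. ?b t j"]) (simp add: pair_measure_countable)
  also have "\<dots> = (\<Sum>j. \<Sum>l. a j l)"
  proof (rule suminf_cong)
    fix j
    have "(\<Sum>t. ?b t j) = (\<Sum>l. ?b (l + j) j)"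
      using suminf_offset[of "\<lambda>t. ?b t j" j] by simp
    then show "(\<Sum>t. ?b t j) = (\<Sum>l. a j l)"
      by simp
  qed
  finally show ?thesis .
qed

text \<open>Pascal's rule in summed form: one more point joins either the \<open>j\<close> points of
  the first kind or the rest.\<close>

lemma sum_binomial_Suc:
  fixes a :: "nat \<Rightarrow> 'a :: comm_semiring_1"
  shows "(\<Sum>j\<le>Suc t. of_nat (Suc t choose j) * a j) = (\<Sum>j\<le>t. of_nat (t choose j) * (a (Suc j) + a j))"
proof -
  have "(\<Sum>j\<le>t. of_nat (t choose j) * a j) = (\<Sum>j\<le>Suc t. of_nat (t choose j) * a j)"
    by (simp add: binomial_eq_0)
  also have "\<dots> = a 0 + (\<Sum>j\<le>t. of_nat (t choose Suc j) * a (Suc j))"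
    by (subst sum.atMost_Suc_shift) simp
  finally have "(\<Sum>j\<le>t. of_nat (t choose j) * a j) = \<dots>" .
  moreover have "(\<Sum>j\<le>Suc t. of_nat (Suc t choose j) * a j) =
      a 0 + (\<Sum>j\<le>t. of_nat (Suc t choose Suc j) * a (Suc j))"
    by (subst sum.atMost_Suc_shift) simp
  ultimately show ?thesis
    by (simp add: distrib_left distrib_right sum.distrib add_ac)
qed

lemma inverse_fact_mult_binomial:
  assumes "j \<le> t"
  shows "ennreal (1 / fact t) * of_nat (t choose j) = ennreal (1 / fact j) * ennreal (1 / fact (t - j))"
proof -
  have "1 / fact t * real (t choose j) = 1 / fact j * (1 / fact (t - j))"
    using assms by (simp add: binomial_fact)
  then show ?thesis
    by (simp add: ennreal_of_nat_eq_real_of_nat ennreal_mult[symmetric])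
qed

lemma exp_neg_tangent: "exp (- z) * (1 + z) \<le> exp (- y) + exp (- z) * y" for y z :: real
proof -
  have "exp (- z) * (1 + (z - y)) \<le> exp (- z) * exp (z - y)"
    by (intro mult_left_mono exp_ge_add_one_self) simp
  also have "\<dots> = exp (- y)"
    by (simp flip: exp_add)
  finally show ?thesis
    by (simp add: algebra_simps)
qed

text \<open>Here \<open>a\<close> and \<open>b\<close> stand for partition functions whose ratio
  \<open>b / a\<close> is at least \<open>exp (- y)\<close>. The tangent of \<open>exp (- y)\<close>
  at \<open>z\<close> is linear in \<open>y\<close>, so it can be averaged when \<open>y\<close> is
  random. For \<open>1 + z \<le> 0\<close> the coefficient is truncated to 0 by
  \<open>ennreal\<close>.\<close>

lemma ennreal_tangent_bound:
  fixes a b :: ennreal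
  assumes ab: "a \<le> b * ennreal (exp y)" and y: "0 \<le> y"
  shows "ennreal (exp (- z) * (1 + z)) * a \<le> b + ennreal (exp (- z)) * (ennreal y * a)"
proof (cases "1 + z \<le> 0")
  case True
  then have "exp (- z) * (1 + z) \<le> 0"
    by (simp add: mult_nonneg_nonpos)
  then show ?thesis
    by (simp add: ennreal_neg)
next
  case False
  have "ennreal (exp (- z) * (1 + z)) * a \<le> ennreal (exp (- y) + exp (- z) * y) * a"
    by (intro mult_right_mono ennreal_leI exp_neg_tangent) simp
  also have "\<dots> = ennreal (exp (- y)) * a + ennreal (exp (- z)) * (ennreal y * a)"
    using y by (simp add: ennreal_plus ennreal_mult algebra_simps)
  also have "ennreal (exp (- y)) * a \<le> ennreal (exp (- y)) * (b * ennreal (exp y))"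
    by (intro mult_left_mono ab) simp
  also have "\<dots> = b * ennreal (exp (- y) * exp y)"
    by (simp add: ennreal_mult mult_ac)
  also have "\<dots> = b"
    by (simp flip: exp_add)
  finally show ?thesis
    by simp
qed

text \<open>The combinatorial part uses only a symmetric interaction between 0 and 1. The factor
  \<open>1 - e x y\<close> takes the place of the indicator that \<open>y\<close> lies in the
  excluded region of \<open>x\<close>.\<close>

locale repulsive_gas = sigma_finite_measure M for M :: "'a measure" +
  fixes e :: "'a \<Rightarrow> 'a \<Rightarrow> ennreal"
  assumes e_measurable_pair: "(\<lambda>(x, y). e x y) \<in> borel_measurable (M \<Otimes>\<^sub>M M)"
    and e_sym: "e x y = e y x"
    and e_le_1: "e x y \<le> 1"
begin

sublocale product_sigma_finite "\<lambda>_::nat. M"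
  by standard

abbreviation conf_measure :: "nat \<Rightarrow> (nat \<Rightarrow> 'a) measure" where
  "conf_measure t \<equiv> Pi\<^sub>M {..<t} (\<lambda>_. M)"

definition boltz :: "nat \<Rightarrow> (nat \<Rightarrow> 'a) \<Rightarrow> ennreal" where
  "boltz t xs = (\<Prod>j<t. \<Prod>i<j. e (xs i) (xs j))"

text \<open>The functional \<open>\<Phi>\<close> is applied to the activity that \<open>g2\<close> leaves to the inner points once \<open>j\<close> outer
  points with activity \<open>g1\<close> have been placed.\<close>
definition outer ::
    "nat \<Rightarrow> (('a \<Rightarrow> ennreal) \<Rightarrow> ennreal) \<Rightarrow> ('a \<Rightarrow> ennreal) \<Rightarrow> ('a \<Rightarrow> ennreal) \<Rightarrow> ennreal" where
  "outer j \<Phi> g1 g2 =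
     (\<integral>\<^sup>+ys. boltz j ys * (\<Prod>i<j. g1 (ys i)) * \<Phi> (\<lambda>y. g2 y * (\<Prod>i<j. e (ys i) y)) \<partial>conf_measure j)"

definition weight :: "nat \<Rightarrow> ('a \<Rightarrow> ennreal) \<Rightarrow> ennreal" where
  "weight t g = (\<integral>\<^sup>+xs. boltz t xs * (\<Prod>i<t. g (xs i)) \<partial>conf_measure t)"

definition partition_fun :: "('a \<Rightarrow> ennreal) \<Rightarrow> ennreal" where
  "partition_fun g = (\<Sum>t. ennreal (1 / fact t) * weight t g)"

lemma weight_eq_outer: "weight t g = outer t (\<lambda>_. 1) g h"
  by (simp add: weight_def outer_def)

lemma measurable_e [measurable (raw)]:
  assumes "f \<in> N \<rightarrow>\<^sub>M M" "h \<in> N \<rightarrow>\<^sub>M M"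
  shows "(\<lambda>p. e (f p) (h p)) \<in> borel_measurable N"
  using measurable_compose[OF measurable_Pair[OF assms] e_measurable_pair] by simp

lemma measurable_boltz [measurable (raw)]:
  assumes [measurable]: "\<And>i. i < t \<Longrightarrow> (\<lambda>p. xs p i) \<in> N \<rightarrow>\<^sub>M M"
  shows "(\<lambda>p. boltz t (xs p)) \<in> borel_measurable N"
  unfolding boltz_def by measurable

lemma sigma_finite_conf: "sigma_finite_measure (conf_measure t)"
  by (rule sigma_finite) simp

text \<open>Activities carry no sigma-algebra of their own, so measurability of the functional is
  assumed along the family of activities that the outer points can leave.\<close>

lemma measurable_outer [measurable (raw)]:
  assumes g1: "(\<lambda>(p, x). G1 p x) \<in> borel_measurable (N \<Otimes>\<^sub>M M)"
    and \<Phi>: "(\<lambda>(p, ys). \<Phi> p (\<lambda>y. G2 p y * (\<Prod>i<j. e (ys i) y))) \<in> borel_measurable (N \<Otimes>\<^sub>M conf_measure j)"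
  shows "(\<lambda>p. outer j (\<Phi> p) (G1 p) (G2 p)) \<in> borel_measurable N"
proof -
  interpret C: sigma_finite_measure "conf_measure j"
    by (rule sigma_finite_conf)
  have [measurable (raw)]: "(\<lambda>q. G1 (f q) (h q)) \<in> borel_measurable L"
    if "f \<in> L \<rightarrow>\<^sub>M N" "h \<in> L \<rightarrow>\<^sub>M M" for L :: "'c measure" and f h
    using measurable_compose[OF measurable_Pair[OF that] g1] by simp
  note \<Phi>[measurable]
  show ?thesis
    unfolding outer_def by measurable
qed

lemma measurable_weight [measurable (raw)]:
  assumes "(\<lambda>(p, x). G p x) \<in> borel_measurable (N \<Otimes>\<^sub>M M)"
  shows "(\<lambda>p. weight t (G p)) \<in> borel_measurable N"
  unfolding weight_eq_outer[where h = undefined] using assms by measurable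

lemma measurable_partition_fun [measurable (raw)]:
  assumes [measurable]: "(\<lambda>(p, x). G p x) \<in> borel_measurable (N \<Otimes>\<^sub>M M)"
  shows "(\<lambda>p. partition_fun (G p)) \<in> borel_measurable N"
  unfolding partition_fun_def by measurable

section \<open>Splitting configurations into outer and inner points\<close>

text \<open>The last outer point \<open>x\<close> interacts with the other outer points and with the
  inner ones. Both effects are absorbed by multiplying both activities by \<open>e x\<close>, so
  removing a point stays within the same class of integrals.\<close>

lemma outer_Suc:
  assumes [measurable]: "g1 \<in> borel_measurable M"
    and \<Phi>[measurable]: "(\<lambda>ys. \<Phi> (\<lambda>y. g2 y * (\<Prod>i<Suc j. e (ys i) y))) \<in> borel_measurable (conf_measure (Suc j))"
  shows "outer (Suc j) \<Phi> g1 g2 = (\<integral>\<^sup>+x. g1 x * outer j \<Phi> (\<lambda>y. g1 y * e x y) (\<lambda>y. g2 y * e x y) \<partial>M)"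
proof -
  let ?F = "\<lambda>ys. boltz (Suc j) ys * (\<Prod>i<Suc j. g1 (ys i)) * \<Phi> (\<lambda>y. g2 y * (\<Prod>i<Suc j. e (ys i) y))"
  let ?G = "\<lambda>x ys. boltz j ys * (\<Prod>i<j. g1 (ys i) * e x (ys i)) * \<Phi> (\<lambda>y. (g2 y * e x y) * (\<Prod>i<j. e (ys i) y))"
  have eq: "?F (ys(j := x)) = g1 x * ?G x ys" for ys x
  proof -
    have "boltz (Suc j) (ys(j := x)) = boltz j ys * (\<Prod>i<j. e x (ys i))"
      by (simp add: boltz_def e_sym[of x])
    then show ?thesis
      by (simp add: prod.distrib mult_ac)
  qed
  have "outer (Suc j) \<Phi> g1 g2 = (\<integral>\<^sup>+x. (\<integral>\<^sup>+ys. ?F (ys(j := x)) \<partial>conf_measure j) \<partial>M)"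
    unfolding outer_def lessThan_Suc
    by (rule product_nn_integral_insert_rev) (use \<Phi> in \<open>auto simp: lessThan_Suc[symmetric]\<close>)
  also have "\<dots> = (\<integral>\<^sup>+x. g1 x * (\<integral>\<^sup>+ys. ?G x ys \<partial>conf_measure j) \<partial>M)"
  proof (rule nn_integral_cong)
    fix x assume x[measurable]: "x \<in> space M"
    have upd: "(\<lambda>ys. ys(j := x)) \<in> conf_measure j \<rightarrow>\<^sub>M conf_measure (Suc j)"
      unfolding lessThan_Suc using x by (intro measurable_fun_upd[where J = "{..<j}"]) auto
    have [measurable]: "(\<lambda>ys. \<Phi> (\<lambda>y. (g2 y * e x y) * (\<Prod>i<j. e (ys i) y))) \<in> borel_measurable (conf_measure j)"
      using measurable_compose[OF upd \<Phi>] by (simp add: mult_ac)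
    show "(\<integral>\<^sup>+ys. ?F (ys(j := x)) \<partial>conf_measure j) = g1 x * (\<integral>\<^sup>+ys. ?G x ys \<partial>conf_measure j)"
      unfolding eq by (rule nn_integral_cmult) measurable
  qed
  finally show ?thesis
    by (simp add: outer_def)
qed

lemma weight_0 [simp]: "weight 0 g = 1"
  by (simp add: weight_def boltz_def PiM_empty nn_integral_count_space_finite)

lemma outer_0 [simp]: "outer 0 \<Phi> g1 g2 = \<Phi> g2"
  by (simp add: outer_def boltz_def PiM_empty nn_integral_count_space_finite)

lemma weight_Suc:
  assumes [measurable]: "g \<in> borel_measurable M"
  shows "weight (Suc t) g = (\<integral>\<^sup>+x. g x * weight t (\<lambda>y. g y * e x y) \<partial>M)"
  unfolding weight_eq_outer[where h = "\<lambda>_. 0"] by (subst outer_Suc) auto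

text \<open>The counterpart of \<open>outer_Suc\<close> for an inner point. In the induction an
  outer point is removed first, then the inner one by the induction hypothesis. Fubini and the
  symmetry of \<open>e\<close> exchange their order, and the outer point is put back.\<close>

lemma outer_weight_Suc:
  assumes "g1 \<in> borel_measurable M" "g2 \<in> borel_measurable M"
  shows "outer j (weight (Suc l)) g1 g2 =
    (\<integral>\<^sup>+x. g2 x * outer j (weight l) (\<lambda>y. g1 y * e x y) (\<lambda>y. g2 y * e x y) \<partial>M)"
  using assms
proof (induction j arbitrary: g1 g2)
  case 0
  then show ?case by (simp add: weight_Suc)
next
  case (Suc j)
  note [measurable] = Suc.prems
  interpret P: pair_sigma_finite M M
    by standard
  define Q where "Q x y = outer j (weight l) (\<lambda>z. g1 z * e x z * e y z) (\<lambda>z. g2 z * e x z * e y z)" for x y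
  have Q_measurable[measurable]: "(\<lambda>(x, y). Q x y) \<in> borel_measurable (M \<Otimes>\<^sub>M M)"
    unfolding Q_def by measurable
  have Q_sym: "Q x y = Q y x" for x y
    by (simp add: Q_def mult_ac)
  have "outer (Suc j) (weight (Suc l)) g1 g2 =
      (\<integral>\<^sup>+x. g1 x * outer j (weight (Suc l)) (\<lambda>y. g1 y * e x y) (\<lambda>y. g2 y * e x y) \<partial>M)"
    by (rule outer_Suc) measurable
  also have "\<dots> = (\<integral>\<^sup>+x. g1 x * (\<integral>\<^sup>+y. g2 y * e x y * Q x y \<partial>M) \<partial>M)"
    unfolding Q_def
    by (intro nn_integral_cong arg_cong2[where f = "(*)"] refl Suc.IH) measurable
  also have "\<dots> = (\<integral>\<^sup>+x. (\<integral>\<^sup>+y. g1 x * (g2 y * e x y * Q x y) \<partial>M) \<partial>M)"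
    by (intro nn_integral_cong nn_integral_cmult[symmetric]) measurable
  also have "\<dots> = (\<integral>\<^sup>+y. (\<integral>\<^sup>+x. g1 x * (g2 y * e x y * Q x y) \<partial>M) \<partial>M)"
    by (rule P.Fubini'[of "\<lambda>x y. g1 x * (g2 y * e x y * Q x y)", symmetric]) measurable
  also have "\<dots> = (\<integral>\<^sup>+y. (\<integral>\<^sup>+x. g2 y * (g1 x * e y x * Q y x) \<partial>M) \<partial>M)"
    by (intro nn_integral_cong) (simp add: Q_sym[of _ y for y] e_sym mult_ac)
  also have "\<dots> = (\<integral>\<^sup>+y. g2 y * (\<integral>\<^sup>+x. g1 x * e y x * Q y x \<partial>M) \<partial>M)"
    by (intro nn_integral_cong nn_integral_cmult) measurable
  also have "\<dots> = (\<integral>\<^sup>+y. g2 y * outer (Suc j) (weight l) (\<lambda>z. g1 z * e y z) (\<lambda>z. g2 z * e y z) \<partial>M)"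
    unfolding Q_def
    by (intro nn_integral_cong arg_cong2[where f = "(*)"] refl outer_Suc[symmetric]) measurable
  finally show ?case .
qed

text \<open>A binomial theorem for interacting points. Removing points one at a time avoids
  expanding the product of \<open>g1 + g2\<close> over subsets of the index set.\<close>

lemma weight_add:
  assumes "g1 \<in> borel_measurable M" "g2 \<in> borel_measurable M"
  shows "weight t (\<lambda>x. g1 x + g2 x) = (\<Sum>j\<le>t. of_nat (t choose j) * outer j (weight (t - j)) g1 g2)"
  using assms
proof (induction t arbitrary: g1 g2)
  case 0
  then show ?case by simp
next
  case (Suc t)
  note [measurable] = Suc.prems
  let ?O = "\<lambda>j x. outer j (weight (t - j)) (\<lambda>y. g1 y * e x y) (\<lambda>y. g2 y * e x y)"
  have "weight (Suc t) (\<lambda>x. g1 x + g2 x) =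
      (\<integral>\<^sup>+x. (g1 x + g2 x) * weight t (\<lambda>y. g1 y * e x y + g2 y * e x y) \<partial>M)"
    by (subst weight_Suc) (auto simp: distrib_right)
  also have "\<dots> = (\<integral>\<^sup>+x. (g1 x + g2 x) * (\<Sum>j\<le>t. of_nat (t choose j) * ?O j x) \<partial>M)"
    by (intro nn_integral_cong arg_cong2[where f = "(*)"] refl Suc.IH) measurable
  also have "\<dots> = (\<integral>\<^sup>+x. (\<Sum>j\<le>t. of_nat (t choose j) * (g1 x * ?O j x + g2 x * ?O j x)) \<partial>M)"
    by (intro nn_integral_cong) (simp add: sum_distrib_left algebra_simps)
  also have "\<dots> = (\<Sum>j\<le>t. of_nat (t choose j) * ((\<integral>\<^sup>+x. g1 x * ?O j x \<partial>M) + (\<integral>\<^sup>+x. g2 x * ?O j x \<partial>M)))"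
    by (subst nn_integral_sum) (auto simp: nn_integral_cmult nn_integral_add)
  also have "\<dots> = (\<Sum>j\<le>t. of_nat (t choose j) *
      (outer (Suc j) (weight (t - j)) g1 g2 + outer j (weight (Suc (t - j))) g1 g2))"
    using Suc.prems by (simp add: outer_Suc outer_weight_Suc)
  also have "\<dots> = (\<Sum>j\<le>t. of_nat (t choose j) *
      (outer (Suc j) (weight (Suc t - Suc j)) g1 g2 + outer j (weight (Suc t - j)) g1 g2))"
    by (intro sum.cong refl) (simp add: Suc_diff_le)
  also have "\<dots> = (\<Sum>j\<le>Suc t. of_nat (Suc t choose j) * outer j (weight (Suc t - j)) g1 g2)"
    by (rule sum_binomial_Suc[symmetric])
  finally show ?case .
qed

text \<open>When positive and finite, \<open>partition_fun (\<lambda>x. g1 x + g2 x)\<close>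
  normalizes this: the outer configuration has density proportional to its weight times
  \<open>partition_fun \<tau>\<close>, where \<open>\<tau>\<close> is the activity left inside. So
  \<open>outer_sum \<Phi>\<close> is the total partition function times the expectation of
  \<open>\<Phi> \<tau> / partition_fun \<tau>\<close>.\<close>

definition outer_sum ::
    "(('a \<Rightarrow> ennreal) \<Rightarrow> ennreal) \<Rightarrow> ('a \<Rightarrow> ennreal) \<Rightarrow> ('a \<Rightarrow> ennreal) \<Rightarrow> ennreal" where
  "outer_sum \<Phi> g1 g2 = (\<Sum>j. ennreal (1 / fact j) * outer j \<Phi> g1 g2)"

lemma outer_partition_fun:
  assumes [measurable]: "g1 \<in> borel_measurable M" "g2 \<in> borel_measurable M"
  shows "outer j partition_fun g1 g2 = (\<Sum>l. ennreal (1 / fact l) * outer j (weight l) g1 g2)"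
proof -
  let ?h = "\<lambda>ys. boltz j ys * (\<Prod>i<j. g1 (ys i))"
  let ?r = "\<lambda>ys y. g2 y * (\<Prod>i<j. e (ys i) y)"
  have "outer j partition_fun g1 g2 =
      (\<integral>\<^sup>+ys. (\<Sum>l. ennreal (1 / fact l) * (?h ys * weight l (?r ys))) \<partial>conf_measure j)"
    unfolding outer_def partition_fun_def ennreal_suminf_cmult[symmetric]
    by (simp add: mult_ac)
  also have "\<dots> = (\<Sum>l. \<integral>\<^sup>+ys. ennreal (1 / fact l) * (?h ys * weight l (?r ys)) \<partial>conf_measure j)"
    by (rule nn_integral_suminf) measurable
  also have "\<dots> = (\<Sum>l. ennreal (1 / fact l) * outer j (weight l) g1 g2)"
    unfolding outer_def by (intro suminf_cong nn_integral_cmult) measurable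
  finally show ?thesis .
qed

lemma partition_fun_add:
  assumes [measurable]: "g1 \<in> borel_measurable M" "g2 \<in> borel_measurable M"
  shows "partition_fun (\<lambda>x. g1 x + g2 x) = outer_sum partition_fun g1 g2"
proof -
  let ?a = "\<lambda>j l. ennreal (1 / fact j) * (ennreal (1 / fact l) * outer j (weight l) g1 g2)"
  have "partition_fun (\<lambda>x. g1 x + g2 x) = (\<Sum>t. \<Sum>j\<le>t. ?a j (t - j))"
    unfolding partition_fun_def
  proof (rule suminf_cong)
    fix t
    show "ennreal (1 / fact t) * weight t (\<lambda>x. g1 x + g2 x) = (\<Sum>j\<le>t. ?a j (t - j))"
      by (simp add: weight_add[OF assms] sum_distrib_left mult.assoc[symmetric] inverse_fact_mult_binomial)
  qed
  also have "\<dots> = outer_sum partition_fun g1 g2"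
    unfolding suminf_ennreal_diagonal[of ?a] outer_sum_def outer_partition_fun[OF assms] ennreal_suminf_cmult ..
  finally show ?thesis .
qed

lemma e_add_compl: "e x y + (1 - e x y) = 1"
  by (rule add_diff_inverse_ennreal[OF e_le_1])

lemma boltz_le_1: "boltz t xs \<le> 1"
  unfolding boltz_def by (intro prod_le_1 conjI e_le_1) simp_all

lemma weight_le_power:
  assumes [measurable]: "g \<in> borel_measurable M"
  shows "weight t g \<le> (\<integral>\<^sup>+x. g x \<partial>M) ^ t"
proof -
  have "weight t g \<le> (\<integral>\<^sup>+xs. (\<Prod>i<t. g (xs i)) \<partial>conf_measure t)"
    unfolding weight_def
    by (intro nn_integral_mono) (use boltz_le_1 mult_right_mono[of "boltz t _" 1] in auto)
  also have "\<dots> = (\<integral>\<^sup>+x. g x \<partial>M) ^ t"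
    by (subst product_nn_integral_prod) auto
  finally show ?thesis .
qed

lemma weight_mono: "(\<And>x. g x \<le> h x) \<Longrightarrow> weight t g \<le> weight t h"
  unfolding weight_def by (intro nn_integral_mono mult_left_mono prod_mono_ennreal) auto

lemma partition_fun_mono: "(\<And>x. g x \<le> h x) \<Longrightarrow> partition_fun g \<le> partition_fun h"
  unfolding partition_fun_def by (intro suminf_le mult_left_mono weight_mono) auto

text \<open>Comparison with the gas without interaction, whose partition function is exactly the
  exponential of the total activity.\<close>

lemma partition_fun_le_exp:
  assumes [measurable]: "g \<in> borel_measurable M" and y: "(\<integral>\<^sup>+x. g x \<partial>M) = ennreal y" "0 \<le> y"
  shows "partition_fun g \<le> ennreal (exp y)"
proof -
  have "partition_fun g \<le> (\<Sum>t. ennreal (1 / fact t) * ennreal y ^ t)"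
    unfolding partition_fun_def y(1)[symmetric]
    by (intro suminf_le mult_left_mono weight_le_power) auto
  also have "\<dots> = (\<Sum>t. ennreal (y ^ t /\<^sub>R fact t))"
    using y(2) by (simp add: ennreal_power ennreal_mult[symmetric] divide_inverse)
  also have "\<dots> = ennreal (exp y)"
    using y(2) exp_converges[of y] by (intro suminf_ennreal_eq) auto
  finally show ?thesis .
qed

section \<open>Expected numbers of points\<close>

text \<open>By \<open>moment_eq\<close> this is the expected number of points times \<open>partition_fun g\<close>.\<close>
definition moment :: "('a \<Rightarrow> ennreal) \<Rightarrow> ennreal" where
  "moment g = (\<integral>\<^sup>+x. g x * partition_fun (\<lambda>y. g y * e x y) \<partial>M)"

lemma measurable_moment [measurable (raw)]:
  assumes g: "(\<lambda>(p, x). G p x) \<in> borel_measurable (N \<Otimes>\<^sub>M M)"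
  shows "(\<lambda>p. moment (G p)) \<in> borel_measurable N"
proof -
  have [measurable (raw)]: "(\<lambda>q. G (f q) (h q)) \<in> borel_measurable L"
    if "f \<in> L \<rightarrow>\<^sub>M N" "h \<in> L \<rightarrow>\<^sub>M M" for L :: "(('b \<times> 'a) \<times> 'a) measure" and f h
    using measurable_compose[OF measurable_Pair[OF that] g] by simp
  have [measurable (raw)]: "(\<lambda>q. G (f q) (h q)) \<in> borel_measurable L"
    if "f \<in> L \<rightarrow>\<^sub>M N" "h \<in> L \<rightarrow>\<^sub>M M" for L :: "('b \<times> 'a) measure" and f h
    using measurable_compose[OF measurable_Pair[OF that] g] by simp
  show ?thesis
    unfolding moment_def by measurable
qed

text \<open>The shift of index turns \<open>t / fact t\<close> into \<open>1 / fact (t - 1)\<close>,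
  so the right-hand side is the sum of \<open>weight t g / fact t\<close> weighted by the number
  \<open>t\<close> of points.\<close>

lemma moment_eq:
  assumes [measurable]: "g \<in> borel_measurable M"
  shows "moment g = (\<Sum>t. ennreal (1 / fact t) * weight (Suc t) g)"
proof -
  have "moment g = (\<integral>\<^sup>+x. (\<Sum>t. ennreal (1 / fact t) * (g x * weight t (\<lambda>y. g y * e x y))) \<partial>M)"
    unfolding moment_def partition_fun_def ennreal_suminf_cmult[symmetric] by (simp add: mult_ac)
  also have "\<dots> = (\<Sum>t. \<integral>\<^sup>+x. ennreal (1 / fact t) * (g x * weight t (\<lambda>y. g y * e x y)) \<partial>M)"
    by (rule nn_integral_suminf) measurable
  also have "\<dots> = (\<Sum>t. ennreal (1 / fact t) * weight (Suc t) g)"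
    by (simp add: nn_integral_cmult weight_Suc)
  finally show ?thesis .
qed

lemma outer_moment:
  assumes [measurable]: "g1 \<in> borel_measurable M" "g2 \<in> borel_measurable M"
  shows "outer j moment g1 g2 =
    (\<integral>\<^sup>+x. g2 x * outer j partition_fun (\<lambda>y. g1 y * e x y) (\<lambda>y. g2 y * e x y) \<partial>M)"
proof -
  let ?h = "\<lambda>ys. boltz j ys * (\<Prod>i<j. g1 (ys i))"
  let ?r = "\<lambda>ys y. g2 y * (\<Prod>i<j. e (ys i) y)"
  have "outer j moment g1 g2 =
      (\<integral>\<^sup>+ys. (\<Sum>l. ennreal (1 / fact l) * (?h ys * weight (Suc l) (?r ys))) \<partial>conf_measure j)"
    unfolding outer_def
  proof (rule nn_integral_cong)
    fix ys assume ys[measurable]: "ys \<in> space (conf_measure j)"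
    have "ys i \<in> space M" if "i < j" for i
      using ys that by (auto simp: space_PiM PiE_iff)
    then have "?r ys \<in> borel_measurable M"
      by measurable
    from moment_eq[OF this]
    show "?h ys * moment (?r ys) = (\<Sum>l. ennreal (1 / fact l) * (?h ys * weight (Suc l) (?r ys)))"
      by (simp only: ennreal_suminf_cmult[symmetric] mult.left_commute[of "ennreal _"])
  qed
  also have "\<dots> = (\<Sum>l. \<integral>\<^sup>+ys. ennreal (1 / fact l) * (?h ys * weight (Suc l) (?r ys)) \<partial>conf_measure j)"
    by (rule nn_integral_suminf) measurable
  also have "\<dots> = (\<Sum>l. ennreal (1 / fact l) * outer j (weight (Suc l)) g1 g2)"
    unfolding outer_def by (intro suminf_cong nn_integral_cmult) measurable
  also have "\<dots> = (\<Sum>l. ennreal (1 / fact l) *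
      (\<integral>\<^sup>+x. g2 x * outer j (weight l) (\<lambda>y. g1 y * e x y) (\<lambda>y. g2 y * e x y) \<partial>M))"
    by (simp add: outer_weight_Suc)
  also have "\<dots> = (\<Sum>l. \<integral>\<^sup>+x. ennreal (1 / fact l) *
      (g2 x * outer j (weight l) (\<lambda>y. g1 y * e x y) (\<lambda>y. g2 y * e x y)) \<partial>M)"
    by (intro suminf_cong nn_integral_cmult[symmetric]) measurable
  also have "\<dots> = (\<integral>\<^sup>+x. (\<Sum>l. ennreal (1 / fact l) *
      (g2 x * outer j (weight l) (\<lambda>y. g1 y * e x y) (\<lambda>y. g2 y * e x y))) \<partial>M)"
    by (rule nn_integral_suminf[symmetric]) measurable
  also have "\<dots> = (\<integral>\<^sup>+x. g2 x * outer j partition_fun (\<lambda>y. g1 y * e x y) (\<lambda>y. g2 y * e x y) \<partial>M)"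
    unfolding mult.left_commute[of "ennreal _"] ennreal_suminf_cmult
    by (intro nn_integral_cong arg_cong2[where f = "(*)"] refl outer_partition_fun[symmetric]) measurable
  finally show ?thesis .
qed

text \<open>The left-hand side averages the number of inner points over the outer configuration. The
  right-hand side counts the \<open>g2\<close>-points in the whole gas at once: condition on one
  such point \<open>x\<close> and let all others form a gas of activity
  \<open>(g1 + g2) * e x\<close>.\<close>

lemma outer_sum_moment:
  assumes [measurable]: "g1 \<in> borel_measurable M" "g2 \<in> borel_measurable M"
  shows "outer_sum moment g1 g2 = (\<integral>\<^sup>+x. g2 x * partition_fun (\<lambda>y. (g1 y + g2 y) * e x y) \<partial>M)"
proof -
  let ?O = "\<lambda>j x. outer j partition_fun (\<lambda>y. g1 y * e x y) (\<lambda>y. g2 y * e x y)"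
  have "outer_sum moment g1 g2 = (\<Sum>j. \<integral>\<^sup>+x. ennreal (1 / fact j) * (g2 x * ?O j x) \<partial>M)"
    unfolding outer_sum_def outer_moment[OF assms]
    by (intro suminf_cong nn_integral_cmult[symmetric]) measurable
  also have "\<dots> = (\<integral>\<^sup>+x. (\<Sum>j. ennreal (1 / fact j) * (g2 x * ?O j x)) \<partial>M)"
    by (rule nn_integral_suminf[symmetric]) measurable
  also have "\<dots> = (\<integral>\<^sup>+x. g2 x * partition_fun (\<lambda>y. (g1 y + g2 y) * e x y) \<partial>M)"
    unfolding mult.left_commute[of "ennreal _"] ennreal_suminf_cmult distrib_right outer_sum_def[symmetric]
    by (intro nn_integral_cong arg_cong2[where f = "(*)"] refl partition_fun_add[symmetric]) measurable
  finally show ?thesis .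
qed

text \<open>All that the later estimates use about the activity left inside is that it is measurable
  and dominated by \<open>g2\<close>.\<close>

lemma outer_sum_mono:
  assumes [measurable]: "g2 \<in> borel_measurable M"
    and le: "\<And>\<tau>. \<tau> \<in> borel_measurable M \<Longrightarrow> (\<And>x. \<tau> x \<le> g2 x) \<Longrightarrow> \<Phi> \<tau> \<le> \<Psi> \<tau>"
  shows "outer_sum \<Phi> g1 g2 \<le> outer_sum \<Psi> g1 g2"
  unfolding outer_sum_def outer_def
proof (intro suminf_le mult_left_mono nn_integral_mono le)
  fix j ys x
  assume ys: "ys \<in> space (conf_measure j)"
  then have "ys i \<in> space M" if "i < j" for i
    using that by (auto simp: space_PiM PiE_iff)
  then show "(\<lambda>y. g2 y * (\<Prod>i<j. e (ys i) y)) \<in> borel_measurable M"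
    by measurable
  have "(\<Prod>i<j. e (ys i) x) \<le> 1"
    by (intro prod_le_1 conjI e_le_1) simp
  then show "g2 x * (\<Prod>i<j. e (ys i) x) \<le> g2 x"
    using mult_left_mono[of "\<Prod>i<j. e (ys i) x" 1 "g2 x"] by simp
qed simp_all

text \<open>Besides combining two functionals, this covers scalar multiples and constants: the later
  instances with \<open>0 * 1\<close> serve only to match this form.\<close>

lemma outer_sum_linear:
  assumes [measurable]: "g1 \<in> borel_measurable M"
    and [measurable]: "\<And>j. (\<lambda>ys. \<Phi> (\<lambda>y. g2 y * (\<Prod>i<j. e (ys i) y))) \<in> borel_measurable (conf_measure j)"
    and [measurable]: "\<And>j. (\<lambda>ys. \<Psi> (\<lambda>y. g2 y * (\<Prod>i<j. e (ys i) y))) \<in> borel_measurable (conf_measure j)"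
  shows "outer_sum (\<lambda>\<tau>. a * \<Phi> \<tau> + b * \<Psi> \<tau>) g1 g2 = a * outer_sum \<Phi> g1 g2 + b * outer_sum \<Psi> g1 g2"
proof -
  have outer_linear: "outer j (\<lambda>\<tau>. a * \<Phi> \<tau> + b * \<Psi> \<tau>) g1 g2 = a * outer j \<Phi> g1 g2 + b * outer j \<Psi> g1 g2" for j
  proof -
    let ?h = "\<lambda>ys. boltz j ys * (\<Prod>i<j. g1 (ys i))"
    let ?r = "\<lambda>ys y. g2 y * (\<Prod>i<j. e (ys i) y)"
    have "outer j (\<lambda>\<tau>. a * \<Phi> \<tau> + b * \<Psi> \<tau>) g1 g2 =
        (\<integral>\<^sup>+ys. a * (?h ys * \<Phi> (?r ys)) + b * (?h ys * \<Psi> (?r ys)) \<partial>conf_measure j)"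
      unfolding outer_def by (simp only: distrib_left mult.left_commute[of _ a] mult.left_commute[of _ b])
    also have "\<dots> = (\<integral>\<^sup>+ys. a * (?h ys * \<Phi> (?r ys)) \<partial>conf_measure j) +
        (\<integral>\<^sup>+ys. b * (?h ys * \<Psi> (?r ys)) \<partial>conf_measure j)"
      by (rule nn_integral_add) measurable
    also have "(\<integral>\<^sup>+ys. a * (?h ys * \<Phi> (?r ys)) \<partial>conf_measure j) = a * outer j \<Phi> g1 g2"
      unfolding outer_def by (rule nn_integral_cmult) measurable
    also have "(\<integral>\<^sup>+ys. b * (?h ys * \<Psi> (?r ys)) \<partial>conf_measure j) = b * outer j \<Psi> g1 g2"
      unfolding outer_def by (rule nn_integral_cmult) measurable
    finally show ?thesis .
  qed
  show ?thesis
    unfolding outer_sum_def outer_linear distrib_left mult.left_commute[of _ a] mult.left_commute[of _ b]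
    by (subst suminf_add[symmetric]) (auto simp only: ennreal_suminf_cmult summableI)
qed

lemma outer_sum_1: "outer_sum (\<lambda>_. 1) g1 g2 = partition_fun g1"
  by (simp add: outer_sum_def partition_fun_def weight_eq_outer[where h = g2])

section \<open>Lower bounds for the gas\<close>

text \<open>Given the outer points, the inner gas has activity at most \<open>g2\<close>, so its
  partition function is at most that of \<open>g2\<close>.\<close>

lemma partition_fun_add_le:
  assumes [measurable]: "g1 \<in> borel_measurable M" "g2 \<in> borel_measurable M"
  shows "partition_fun (\<lambda>x. g1 x + g2 x) \<le> partition_fun g1 * partition_fun g2"
proof -
  have "partition_fun (\<lambda>x. g1 x + g2 x) \<le> outer_sum (\<lambda>_. partition_fun g2 * 1 + 0 * 1) g1 g2"
    unfolding partition_fun_add[OF assms] by (intro outer_sum_mono) (auto intro: partition_fun_mono)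
  also have "\<dots> = partition_fun g1 * partition_fun g2"
    by (subst outer_sum_linear) (auto simp: outer_sum_1 mult.commute)
  finally show ?thesis .
qed

text \<open>A Jensen argument. Submultiplicativity gives \<open>partition_fun (\<tau> * e x) \<ge>
  exp (- y x) * partition_fun \<tau>\<close>, where \<open>y x\<close> is the activity excluded by
  \<open>x\<close>. The average of \<open>y\<close> with respect to \<open>\<tau>\<close> is at most
  \<open>\<kappa>\<close>, and the tangent at \<open>\<kappa>\<close> turns this into the factor
  \<open>exp (- \<kappa>)\<close>.\<close>

lemma moment_ge_weighted_partition_fun:
  assumes \<tau>[measurable]: "\<tau> \<in> borel_measurable M" and fin: "(\<integral>\<^sup>+x. \<tau> x \<partial>M) < top" and \<kappa>: "0 \<le> \<kappa>"
    and overlap: "(\<integral>\<^sup>+x. \<tau> x * (\<integral>\<^sup>+y. \<tau> y * (1 - e x y) \<partial>M) \<partial>M) \<le> ennreal \<kappa> * (\<integral>\<^sup>+x. \<tau> x \<partial>M)"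
  shows "ennreal (exp (- \<kappa>)) * ((\<integral>\<^sup>+x. \<tau> x \<partial>M) * partition_fun \<tau>) \<le> moment \<tau>"
proof -
  let ?I = "\<integral>\<^sup>+x. \<tau> x \<partial>M" and ?Z = "partition_fun \<tau>" and ?c = "exp (- \<kappa>)"
  define y where "y x = (\<integral>\<^sup>+y. \<tau> y * (1 - e x y) \<partial>M)" for x
  have [measurable]: "y \<in> borel_measurable M"
    unfolding y_def by measurable
  obtain I where I: "?I = ennreal I" "0 \<le> I"
    using fin by (cases ?I) auto
  have Zfin: "?Z < top"
    using partition_fun_le_exp[OF \<tau> I] by (auto simp: less_top[symmetric] top_unique)
  have pointwise: "ennreal (?c * (1 + \<kappa>)) * ?Z \<le> partition_fun (\<lambda>z. \<tau> z * e x z) + ennreal ?c * (y x * ?Z)"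
    if x[measurable]: "x \<in> space M" for x
  proof -
    have split: "\<tau> = (\<lambda>z. \<tau> z * e x z + \<tau> z * (1 - e x z))"
      by (simp add: distrib_left[symmetric] e_add_compl)
    have "y x \<le> ?I"
      unfolding y_def
      by (intro nn_integral_mono) (use mult_left_mono[of "1 - e x _" 1] in \<open>auto simp: diff_le_self_ennreal\<close>)
    then obtain r where r: "y x = ennreal r" "0 \<le> r"
      using fin by (cases "y x") (auto simp: top_unique)
    have "?Z \<le> partition_fun (\<lambda>z. \<tau> z * e x z) * partition_fun (\<lambda>z. \<tau> z * (1 - e x z))"
      by (subst split, rule partition_fun_add_le) measurable
    also have "\<dots> \<le> partition_fun (\<lambda>z. \<tau> z * e x z) * ennreal (exp r)"
      using r by (intro mult_left_mono partition_fun_le_exp) (auto simp: y_def)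
    finally show ?thesis
      using ennreal_tangent_bound[OF _ r(2)] r(1) by simp
  qed
  have "ennreal (?c * (1 + \<kappa>)) * (?I * ?Z) = (\<integral>\<^sup>+x. \<tau> x * (ennreal (?c * (1 + \<kappa>)) * ?Z) \<partial>M)"
    by (simp add: nn_integral_multc mult_ac)
  also have "\<dots> \<le> (\<integral>\<^sup>+x. \<tau> x * (partition_fun (\<lambda>z. \<tau> z * e x z) + ennreal ?c * (y x * ?Z)) \<partial>M)"
    by (intro nn_integral_mono mult_left_mono pointwise) auto
  also have "\<dots> = (\<integral>\<^sup>+x. \<tau> x * partition_fun (\<lambda>z. \<tau> z * e x z) + \<tau> x * y x * (ennreal ?c * ?Z) \<partial>M)"
    by (simp add: algebra_simps)
  also have "\<dots> = moment \<tau> + (\<integral>\<^sup>+x. \<tau> x * y x \<partial>M) * (ennreal ?c * ?Z)"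
    unfolding moment_def by (subst nn_integral_add) (auto simp: nn_integral_multc)
  also have "\<dots> \<le> moment \<tau> + (ennreal \<kappa> * ?I) * (ennreal ?c * ?Z)"
    using overlap by (intro add_left_mono mult_right_mono) (auto simp: y_def)
  also have "\<dots> = moment \<tau> + ennreal (?c * \<kappa>) * (?I * ?Z)"
    using \<kappa> by (simp add: ennreal_mult mult_ac)
  finally have "ennreal ?c * (?I * ?Z) + ennreal (?c * \<kappa>) * (?I * ?Z) \<le> moment \<tau> + ennreal (?c * \<kappa>) * (?I * ?Z)"
    using \<kappa> by (simp add: distrib_left distrib_right ennreal_plus)
  moreover have "ennreal (?c * \<kappa>) * (?I * ?Z) \<noteq> top"
    using Zfin fin by (simp add: ennreal_mult_eq_top_iff less_top)
  ultimately show ?thesis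
    by (simp add: ennreal_add_left_cancel_le add.commute)
qed

text \<open>After division by the total partition function, \<open>partition_fun g1\<close> is the
  probability that there is no inner point. Given the outer points this probability is
  \<open>1 / partition_fun \<tau>\<close>, which is at least the exponential of minus the total
  inner activity; the tangent at \<open>z\<close> makes that linear before averaging.\<close>

lemma outer_weighted_partition_fun:
  assumes [measurable]: "g1 \<in> borel_measurable M" "g2 \<in> borel_measurable M"
    and fin: "(\<integral>\<^sup>+x. g2 x \<partial>M) < top"
  shows "ennreal (exp (- z) * (1 + z)) * partition_fun (\<lambda>x. g1 x + g2 x) \<le>
    partition_fun g1 + ennreal (exp (- z)) * outer_sum (\<lambda>\<tau>. (\<integral>\<^sup>+x. \<tau> x \<partial>M) * partition_fun \<tau>) g1 g2"
proof -
  let ?N = "\<lambda>\<tau>. (\<integral>\<^sup>+x. \<tau> x \<partial>M) * partition_fun \<tau>"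
  let ?c = "ennreal (exp (- z) * (1 + z))" and ?d = "ennreal (exp (- z))"
  have "?c * partition_fun (\<lambda>x. g1 x + g2 x) = outer_sum (\<lambda>\<tau>. ?c * partition_fun \<tau> + 0 * 1) g1 g2"
    by (subst outer_sum_linear) (auto simp: partition_fun_add)
  also have "\<dots> \<le> outer_sum (\<lambda>\<tau>. 1 * 1 + ?d * ?N \<tau>) g1 g2"
  proof (rule outer_sum_mono)
    fix \<tau> assume [measurable]: "\<tau> \<in> borel_measurable M" and le: "\<And>x. \<tau> x \<le> g2 x"
    have "(\<integral>\<^sup>+x. \<tau> x \<partial>M) \<le> (\<integral>\<^sup>+x. g2 x \<partial>M)"
      by (intro nn_integral_mono le)
    with fin obtain I where I: "(\<integral>\<^sup>+x. \<tau> x \<partial>M) = ennreal I" "0 \<le> I"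
      by (cases "\<integral>\<^sup>+x. \<tau> x \<partial>M") (auto simp: top_unique)
    show "?c * partition_fun \<tau> + 0 * 1 \<le> 1 * 1 + ?d * ?N \<tau>"
      using ennreal_tangent_bound[of "partition_fun \<tau>" 1 I z] partition_fun_le_exp[OF _ I] I by simp
  qed measurable
  also have "\<dots> = 1 * outer_sum (\<lambda>_. 1) g1 g2 + ?d * outer_sum ?N g1 g2"
    by (rule outer_sum_linear) measurable
  finally show ?thesis
    by (simp add: outer_sum_1)
qed

text \<open>For a point \<open>v\<close> the inner activity is \<open>g * (1 - e v)\<close>. Its
  mean total is bounded by \<open>exp \<kappa>\<close> times the mean number of inner points,
  through \<open>moment_ge_weighted_partition_fun\<close>. Integration over \<open>v\<close> turns
  the uncovered weight into \<open>moment g\<close>, and the pairs of \<open>v\<close> with an inner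
  point are counted from the inner point, which contributes at most \<open>D\<close>.\<close>

lemma moment_lower_bound:
  assumes g[measurable]: "g \<in> borel_measurable M" and fin: "(\<integral>\<^sup>+x. g x \<partial>M) < top" and \<kappa>: "0 \<le> \<kappa>"
    and excluded: "\<And>x. x \<in> space M \<Longrightarrow> (\<integral>\<^sup>+v. g v * (1 - e v x) \<partial>M) \<le> D"
    and overlap: "\<And>v \<tau>. v \<in> space M \<Longrightarrow> \<tau> \<in> borel_measurable M \<Longrightarrow>
      (\<And>x. \<tau> x \<le> g x * (1 - e v x)) \<Longrightarrow>
      (\<integral>\<^sup>+x. \<tau> x * (\<integral>\<^sup>+y. \<tau> y * (1 - e x y) \<partial>M) \<partial>M) \<le> ennreal \<kappa> * (\<integral>\<^sup>+x. \<tau> x \<partial>M)"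
  shows "ennreal (exp (- z) * (1 + z)) * (partition_fun g * (\<integral>\<^sup>+x. g x \<partial>M)) \<le>
    moment g + ennreal (exp (\<kappa> - z)) * (D * moment g)"
proof -
  let ?N = "\<lambda>\<tau>. (\<integral>\<^sup>+x. \<tau> x \<partial>M) * partition_fun \<tau>"
  let ?c = "ennreal (exp (- z) * (1 + z))" and ?d = "ennreal (exp (- z))"
  define Q where "Q x = partition_fun (\<lambda>y. g y * e x y)" for x
  have Q[measurable]: "Q \<in> borel_measurable M"
    unfolding Q_def by measurable
  interpret P: pair_sigma_finite M M
    by standard
  have at_vertex: "?c * partition_fun g \<le> Q v + ennreal (exp (\<kappa> - z)) * (\<integral>\<^sup>+x. g x * (1 - e v x) * Q x \<partial>M)"
    if v[measurable]: "v \<in> space M" for v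
  proof -
    let ?g1 = "\<lambda>x. g x * e v x" and ?g2 = "\<lambda>x. g x * (1 - e v x)"
    have split: "(\<lambda>x. ?g1 x + ?g2 x) = g"
      by (simp add: distrib_left[symmetric] e_add_compl)
    have g2_le: "?g2 x \<le> g x" for x
      using mult_left_mono[of "1 - e v x" 1 "g x"] by (simp add: diff_le_self_ennreal)
    have "(\<integral>\<^sup>+x. ?g2 x \<partial>M) \<le> (\<integral>\<^sup>+x. g x \<partial>M)"
      by (intro nn_integral_mono g2_le)
    also note fin
    finally have fin2: "(\<integral>\<^sup>+x. ?g2 x \<partial>M) < top" .
    have "ennreal (exp (- \<kappa>)) * outer_sum ?N ?g1 ?g2 = outer_sum (\<lambda>\<tau>. ennreal (exp (- \<kappa>)) * ?N \<tau> + 0 * 1) ?g1 ?g2"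
      by (subst outer_sum_linear) auto
    also have "\<dots> \<le> outer_sum moment ?g1 ?g2"
    proof (rule outer_sum_mono)
      fix \<tau> assume \<tau>[measurable]: "\<tau> \<in> borel_measurable M" and le: "\<And>x. \<tau> x \<le> ?g2 x"
      have "(\<integral>\<^sup>+x. \<tau> x \<partial>M) \<le> (\<integral>\<^sup>+x. ?g2 x \<partial>M)"
        by (intro nn_integral_mono le)
      then have "(\<integral>\<^sup>+x. \<tau> x \<partial>M) < top"
        using fin2 by simp
      from moment_ge_weighted_partition_fun[OF \<tau> this \<kappa> overlap[OF v \<tau> le]]
      show "ennreal (exp (- \<kappa>)) * ?N \<tau> + 0 * 1 \<le> moment \<tau>"
        by simp
    qed measurable
    also have "\<dots> = (\<integral>\<^sup>+x. g x * (1 - e v x) * Q x \<partial>M)"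
      by (subst outer_sum_moment) (auto simp: split Q_def fun_cong[OF split])
    finally have "ennreal (exp \<kappa>) * (ennreal (exp (- \<kappa>)) * outer_sum ?N ?g1 ?g2) \<le>
        ennreal (exp \<kappa>) * (\<integral>\<^sup>+x. g x * (1 - e v x) * Q x \<partial>M)"
      by (intro mult_left_mono) auto
    then have N_le: "outer_sum ?N ?g1 ?g2 \<le> ennreal (exp \<kappa>) * (\<integral>\<^sup>+x. g x * (1 - e v x) * Q x \<partial>M)"
      by (simp add: mult.assoc[symmetric] ennreal_mult[symmetric] exp_add[symmetric])
    have "?c * partition_fun g \<le> Q v + ?d * outer_sum ?N ?g1 ?g2"
      using outer_weighted_partition_fun[of ?g1 ?g2 z] fin2 by (simp add: split Q_def)
    also have "\<dots> \<le> Q v + ?d * (ennreal (exp \<kappa>) * (\<integral>\<^sup>+x. g x * (1 - e v x) * Q x \<partial>M))"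
      by (intro add_left_mono mult_left_mono N_le) auto
    also have "?d * (ennreal (exp \<kappa>) * (\<integral>\<^sup>+x. g x * (1 - e v x) * Q x \<partial>M)) =
        ennreal (exp (\<kappa> - z)) * (\<integral>\<^sup>+x. g x * (1 - e v x) * Q x \<partial>M)"
      by (simp add: mult.assoc[symmetric] ennreal_mult[symmetric] exp_add[symmetric])
    finally show ?thesis .
  qed
  \<comment> \<open>Double counting: for a fixed point \<open>x\<close> of the gas, the centres
    \<open>v\<close> that it covers have total activity at most \<open>D\<close>.\<close>
  have "(\<integral>\<^sup>+v. g v * (\<integral>\<^sup>+x. g x * (1 - e v x) * Q x \<partial>M) \<partial>M) =
      (\<integral>\<^sup>+v. (\<integral>\<^sup>+x. g v * (g x * (1 - e v x) * Q x) \<partial>M) \<partial>M)"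
    by (intro nn_integral_cong nn_integral_cmult[symmetric]) measurable
  also have "\<dots> = (\<integral>\<^sup>+x. (\<integral>\<^sup>+v. g v * (g x * (1 - e v x) * Q x) \<partial>M) \<partial>M)"
    by (rule P.Fubini'[of "\<lambda>v x. g v * (g x * (1 - e v x) * Q x)", symmetric]) measurable
  also have "\<dots> = (\<integral>\<^sup>+x. (\<integral>\<^sup>+v. (g x * Q x) * (g v * (1 - e v x)) \<partial>M) \<partial>M)"
    by (simp add: mult_ac)
  also have "\<dots> = (\<integral>\<^sup>+x. (g x * Q x) * (\<integral>\<^sup>+v. g v * (1 - e v x) \<partial>M) \<partial>M)"
    by (intro nn_integral_cong nn_integral_cmult) measurable
  also have "\<dots> \<le> (\<integral>\<^sup>+x. (g x * Q x) * D \<partial>M)"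
    by (intro nn_integral_mono mult_left_mono excluded) auto
  also have "\<dots> = D * moment g"
    by (subst nn_integral_multc) (auto simp: moment_def Q_def mult.commute)
  finally have swap: "(\<integral>\<^sup>+v. g v * (\<integral>\<^sup>+x. g x * (1 - e v x) * Q x \<partial>M) \<partial>M) \<le> D * moment g" .
  have "?c * (partition_fun g * (\<integral>\<^sup>+x. g x \<partial>M)) = (\<integral>\<^sup>+v. g v * (?c * partition_fun g) \<partial>M)"
    by (simp add: nn_integral_multc mult_ac)
  also have "\<dots> \<le> (\<integral>\<^sup>+v. g v * (Q v + ennreal (exp (\<kappa> - z)) * (\<integral>\<^sup>+x. g x * (1 - e v x) * Q x \<partial>M)) \<partial>M)"
    by (intro nn_integral_mono mult_left_mono at_vertex) auto
  also have "\<dots> = (\<integral>\<^sup>+v. g v * Q v + ennreal (exp (\<kappa> - z)) * (g v * (\<integral>\<^sup>+x. g x * (1 - e v x) * Q x \<partial>M)) \<partial>M)"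
    by (simp only: distrib_left mult.left_commute[of _ "ennreal _"])
  also have "\<dots> = (\<integral>\<^sup>+v. g v * Q v \<partial>M) +
      ennreal (exp (\<kappa> - z)) * (\<integral>\<^sup>+v. g v * (\<integral>\<^sup>+x. g x * (1 - e v x) * Q x \<partial>M) \<partial>M)"
    by (subst nn_integral_add) (auto simp: nn_integral_cmult)
  also have "\<dots> \<le> moment g + ennreal (exp (\<kappa> - z)) * (D * moment g)"
    by (intro add_mono mult_left_mono swap) (auto simp: moment_def Q_def)
  finally show ?thesis .
qed

end

section \<open>Uniform convexity of the block norm\<close>

text \<open>On \<open>{0<..1}\<close> the second derivative of \<open>t powr p\<close> is at least
  \<open>p * (p - 1)\<close>, because \<open>p \<le> 2\<close>. So subtracting
  \<open>p * (p - 1) / 2 * t\<^sup>2\<close> leaves a convex function, and the midpoint gap of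
  \<open>t\<^sup>2\<close> between 1 and \<open>b\<close> is
  \<open>(1 - b)\<^sup>2 / 4\<close>.\<close>

lemma powr_strongly_convex_midpoint:
  fixes p b :: real
  assumes p: "1 < p" "p \<le> 2" and b: "0 \<le> b" "b \<le> 1"
  shows "((1 + b) / 2) powr p + p * (p - 1) / 8 * (1 - b)\<^sup>2 \<le> (1 + b powr p) / 2"
proof -
  define h where "h t = t powr p - p * (p - 1) / 2 * t\<^sup>2" for t :: real
  have "convex_on {0<..1} h"
  proof (rule f''_ge0_imp_convex)
    fix t :: real assume t: "t \<in> {0<..1}"
    show "(h has_real_derivative p * t powr (p - 1) - p * (p - 1) * t) (at t)"
      unfolding h_def using t by (auto intro!: derivative_eq_intros)
    show "((\<lambda>t. p * t powr (p - 1) - p * (p - 1) * t) has_real_derivative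
        p * ((p - 1) * t powr (p - 2)) - p * (p - 1)) (at t)"
      using t by (auto intro!: derivative_eq_intros simp: field_simps)
    have "1 \<le> t powr (p - 2)"
      using t p powr_mono'[of "p - 2" 0 t] by simp
    then have "p * (p - 1) * 1 \<le> p * (p - 1) * t powr (p - 2)"
      using p by (intro mult_left_mono) auto
    then show "0 \<le> p * ((p - 1) * t powr (p - 2)) - p * (p - 1)"
      by (simp add: mult.assoc)
  qed simp
  then have pos: "((1 + b) / 2) powr p + p * (p - 1) / 8 * (1 - b)\<^sup>2 \<le> (1 + b powr p) / 2"
    if "0 < b" "b \<le> 1" for b
    using convex_onD[of "{0<..1}" h "1/2" 1 b] that
    by (simp add: h_def field_simps power2_eq_square)
  show ?thesis
  \<comment> \<open>For \<open>p < 2\<close> the second derivative blows up at 0, so the endpoint is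
    reached as a limit from the right.\<close>
  proof (cases "b = 0")
    case True
    have "((1 + 0) / 2) powr p + p * (p - 1) / 8 * (1 - 0)\<^sup>2 \<le> (1 + 0 powr p) / 2"
    proof (rule tendsto_le[of "at_right (0::real)"])
      show "((\<lambda>b. (1 + b powr p) / 2) \<longlongrightarrow> (1 + 0 powr p) / 2) (at_right 0)"
        using p by (intro tendsto_intros tendsto_powr2) (auto simp: eventually_at_filter)
      show "((\<lambda>b. ((1 + b) / 2) powr p + p * (p - 1) / 8 * (1 - b)\<^sup>2) \<longlongrightarrow>
          ((1 + 0) / 2) powr p + p * (p - 1) / 8 * (1 - 0)\<^sup>2) (at_right 0)"
        by (intro tendsto_intros) auto
      show "\<forall>\<^sub>F b in at_right 0. ((1 + b) / 2) powr p + p * (p - 1) / 8 * (1 - b)\<^sup>2 \<le> (1 + b powr p) / 2"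
        unfolding eventually_at_right_field by (intro exI[of _ 1] conjI allI impI pos) auto
    qed simp
    with True show ?thesis by simp
  qed (use pos b in auto)
qed

lemma powr_diff_ge_square_diff:
  fixes p m M :: real
  assumes p: "1 < p" "p \<le> 2" and M: "0 \<le> M" "M \<le> m" "0 < m" "m \<le> 1"
  shows "p / 2 * (m\<^sup>2 - M\<^sup>2) \<le> m powr p - M powr p"
proof -
  define \<theta> where "\<theta> = M / m"
  have \<theta>: "0 \<le> \<theta>" "\<theta> \<le> 1" and M_eq: "M = m * \<theta>"
    using M by (auto simp: \<theta>_def)
  \<comment> \<open>Weighted arithmetic-geometric mean of \<open>\<theta>\<^sup>2\<close> and 1 with
    weights \<open>p / 2\<close> and \<open>1 - p / 2\<close>.\<close>
  have bern: "\<theta> powr p \<le> 1 - p / 2 * (1 - \<theta>\<^sup>2)"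
  proof (cases "\<theta> = 0")
    case False
    then have "(\<theta>\<^sup>2) powr (p / 2) * 1 powr (1 - p / 2) \<le> p / 2 * \<theta>\<^sup>2 + (1 - p / 2) * 1"
      using p \<theta> by (intro Youngs_inequality_0) auto
    moreover have "(\<theta>\<^sup>2) powr (p / 2) = \<theta> powr p"
      using \<theta> False by (simp add: powr_powr flip: powr_numeral)
    ultimately show ?thesis
      by (simp add: algebra_simps)
  qed (use p in simp)
  have m2: "m\<^sup>2 \<le> m powr p"
    using p M powr_mono'[of p 2 m] by (simp flip: powr_numeral)
  have "p / 2 * (m\<^sup>2 - M\<^sup>2) = m\<^sup>2 * (p / 2 * (1 - \<theta>\<^sup>2))"
    by (simp add: M_eq power_mult_distrib algebra_simps)
  also have "\<dots> \<le> m powr p * (1 - \<theta> powr p)"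
    using bern m2 p \<theta> by (intro mult_mono) (auto simp: power_le_one)
  also have "\<dots> = m powr p - M powr p"
    using M \<theta> by (simp add: M_eq powr_mult algebra_simps)
  finally show ?thesis .
qed

text \<open>The deficit splits at the mean length \<open>?m\<close>. Unequal lengths contribute at
  least \<open>p * (p - 1) / 8 * (1 - b)\<^sup>2\<close>, and different directions at least
  \<open>p / 8 * (\<gamma>\<^sup>2 - (1 - b)\<^sup>2)\<close>. Weakening the second constant to the
  first makes the \<open>(1 - b)\<^sup>2\<close> terms cancel.\<close>

lemma midpoint_deficit_normalized:
  fixes p b M \<gamma> :: real
  assumes p: "1 < p" "p \<le> 2" and b: "0 \<le> b" "b \<le> 1"
    and M: "0 \<le> M" "M \<le> (1 + b) / 2" and parallelogram: "M\<^sup>2 = (1 + b\<^sup>2) / 2 - \<gamma>\<^sup>2 / 4"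
  shows "p * (p - 1) / 8 * \<gamma>\<^sup>2 \<le> (1 + b powr p) / 2 - M powr p"
proof -
  let ?m = "(1 + b) / 2"
  have sq: "?m\<^sup>2 - M\<^sup>2 = (\<gamma>\<^sup>2 - (1 - b)\<^sup>2) / 4"
    unfolding parallelogram by (simp add: power2_eq_square field_simps)
  have "M\<^sup>2 \<le> ?m\<^sup>2"
    using M by (intro power_mono) auto
  with sq have nonneg: "0 \<le> \<gamma>\<^sup>2 - (1 - b)\<^sup>2"
    by simp
  have "p * (p - 1) / 8 * (\<gamma>\<^sup>2 - (1 - b)\<^sup>2) \<le> p / 8 * (\<gamma>\<^sup>2 - (1 - b)\<^sup>2)"
    using p nonneg by (intro mult_right_mono) auto
  also have "\<dots> = p / 2 * (?m\<^sup>2 - M\<^sup>2)"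
    by (simp add: sq)
  also have "\<dots> \<le> ?m powr p - M powr p"
    using p M b by (intro powr_diff_ge_square_diff) auto
  finally show ?thesis
    using powr_strongly_convex_midpoint[OF p b] unfolding right_diff_distrib[of "p * (p - 1) / 8"] by argo
qed

text \<open>The normalized deficit bound is quadratic in \<open>\<gamma>\<close>, which for
  \<open>p < 2\<close> does not add up over blocks as a bound on p-th powers. Giving away a
  sixteenth of the p-th powers makes it homogeneous of degree \<open>p\<close>.\<close>

lemma block_uniform_convexity:
  fixes p \<alpha> \<beta> \<gamma> M :: real
  assumes p: "1 < p" "p \<le> 2" and nonneg: "0 \<le> \<alpha>" "0 \<le> \<beta>" "0 \<le> \<gamma>"
    and M: "0 \<le> M" "M \<le> (\<alpha> + \<beta>) / 2" and parallelogram: "M\<^sup>2 = (\<alpha>\<^sup>2 + \<beta>\<^sup>2) / 2 - \<gamma>\<^sup>2 / 4"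
  shows "\<gamma> powr p \<le> (\<alpha> powr p + \<beta> powr p) / 16 +
    40 / (p * (p - 1)) * ((\<alpha> powr p + \<beta> powr p) / 2 - M powr p)"
  using nonneg M parallelogram
proof (induction \<alpha> \<beta> rule: linorder_wlog)
  case (sym \<alpha> \<beta>)
  then show ?case by (simp add: add.commute)
next
  case (le \<beta> \<alpha>)
  show ?case
  proof (cases "\<alpha> = 0")
    case True
    with le p show ?thesis by (auto simp: power2_eq_square)
  next
    case False
    define C where "C = 40 / (p * (p - 1))"
    define b g N where "b = \<beta> / \<alpha>" and "g = \<gamma> / \<alpha>" and "N = M / \<alpha>"
    have eqs: "\<beta> = b * \<alpha>" "\<gamma> = g * \<alpha>" "M = N * \<alpha>" and \<alpha>: "0 < \<alpha>"
      using False le by (auto simp: b_def g_def N_def)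
    have b: "0 \<le> b" "b \<le> 1" and g: "0 \<le> g" and N: "0 \<le> N" "N \<le> (1 + b) / 2"
      using le \<alpha> by (auto simp: b_def g_def N_def field_simps)
    have "N\<^sup>2 * \<alpha>\<^sup>2 = ((1 + b\<^sup>2) / 2 - g\<^sup>2 / 4) * \<alpha>\<^sup>2"
      using le by (simp add: eqs power_mult_distrib algebra_simps)
    then have par: "N\<^sup>2 = (1 + b\<^sup>2) / 2 - g\<^sup>2 / 4"
      using \<alpha> by simp
    have g_powr: "g powr p \<le> g + g\<^sup>2"
    proof (cases "g \<le> 1")
      case True
      then show ?thesis
        using g p powr_mono'[of 1 p g] by (simp add: add_increasing2)
    next
      case False
      then show ?thesis
        using g p powr_mono[of p 2 g] by simp
    qed
    \<comment> \<open>With \<open>g powr p \<le> g + g\<^sup>2\<close> this gives the coefficient 5,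
      and \<open>5 = 40 / 8\<close> is the origin of the 40 once the deficit constant
      \<open>p * (p - 1) / 8\<close> is divided out.\<close>
    have "g \<le> 1 / 16 + 4 * g\<^sup>2"
      using zero_le_power2[of "1 / 4 - 2 * g"] by (simp add: power2_eq_square algebra_simps)
    with g_powr have "g powr p \<le> 1 / 16 + 5 * g\<^sup>2"
      by simp
    also have "\<dots> = 1 / 16 + 40 / (p * (p - 1)) * (p * (p - 1) / 8 * g\<^sup>2)"
      using p by simp
    also have "\<dots> \<le> (1 + b powr p) / 16 + 40 / (p * (p - 1)) * ((1 + b powr p) / 2 - N powr p)"
      using p midpoint_deficit_normalized[OF p b N par]
      by (intro add_mono mult_left_mono) auto
    finally have "g powr p * \<alpha> powr p \<le>
        ((1 + b powr p) / 16 + C * ((1 + b powr p) / 2 - N powr p)) * \<alpha> powr p"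
      unfolding C_def by (intro mult_right_mono) auto
    then show ?thesis
      unfolding C_def[symmetric] using \<alpha> b g N by (simp add: eqs powr_mult algebra_simps)
  qed
qed

section \<open>Block norms and lenses\<close>

definition block :: "(nat \<Rightarrow> nat) \<Rightarrow> nat \<Rightarrow> nat set" where
  "block k j = {k j..<k (Suc j)}"

definition blockpow :: "real \<Rightarrow> nat \<Rightarrow> (nat \<Rightarrow> nat) \<Rightarrow> (nat \<Rightarrow> real) \<Rightarrow> real" where
  "blockpow p m k x = (\<Sum>j<m. L2_set x (block k j) powr p)"

lemma blocknorm_eq: "blocknorm p m k x = blockpow p m k x powr (1 / p)"
  by (simp add: blocknorm_def blockpow_def L2_set_def block_def)

lemma blockpow_nonneg: "0 \<le> blockpow p m k x"
  by (simp add: blockpow_def sum_nonneg)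

lemma blocknorm_nonneg: "0 \<le> blocknorm p m k x"
  by (simp add: blocknorm_eq)

lemma blocknorm_powr: "0 < p \<Longrightarrow> blocknorm p m k x powr p = blockpow p m k x"
  by (simp add: blocknorm_eq powr_powr blockpow_nonneg)

lemma powr_le_powr_iff:
  fixes p x y :: real
  assumes "0 < p" "0 \<le> x" "0 \<le> y"
  shows "x powr p \<le> y powr p \<longleftrightarrow> x \<le> y"
  using assms powr_mono2[of p x y] powr_less_mono2[of p y x] by (auto simp: not_le[symmetric])

lemma blocknorm_le_iff:
  assumes "0 < p" "0 \<le> r"
  shows "blocknorm p m k x \<le> r \<longleftrightarrow> blockpow p m k x \<le> r powr p"
  using assms by (simp add: blocknorm_powr[symmetric] blocknorm_nonneg powr_le_powr_iff)

lemma L2_set_scale: "L2_set (\<lambda>i. c * x i) A = \<bar>c\<bar> * L2_set x A"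
  by (simp add: L2_set_def power_mult_distrib sum_distrib_left[symmetric] real_sqrt_mult)

lemma blockpow_scale: "blockpow p m k (\<lambda>i. c * x i) = \<bar>c\<bar> powr p * blockpow p m k x"
  by (simp add: blockpow_def L2_set_scale powr_mult L2_set_nonneg sum_distrib_left)

lemma blocknorm_scale: "0 < p \<Longrightarrow> blocknorm p m k (\<lambda>i. c * x i) = \<bar>c\<bar> * blocknorm p m k x"
  by (simp add: blocknorm_eq blockpow_scale powr_mult powr_powr blockpow_nonneg)

lemma L2_set_midpoint:
  fixes x y :: "'a \<Rightarrow> real"
  shows "L2_set (\<lambda>i. (x i + y i) / 2) A \<le> (L2_set x A + L2_set y A) / 2"
    and "(L2_set (\<lambda>i. (x i + y i) / 2) A)\<^sup>2 =
      ((L2_set x A)\<^sup>2 + (L2_set y A)\<^sup>2) / 2 - (L2_set (\<lambda>i. x i - y i) A)\<^sup>2 / 4"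
proof -
  have "L2_set (\<lambda>i. (x i + y i) / 2) A = L2_set (\<lambda>i. x i + y i) A / 2"
    using L2_set_scale[of "1 / 2" "\<lambda>i. x i + y i" A] by simp
  then show "L2_set (\<lambda>i. (x i + y i) / 2) A \<le> (L2_set x A + L2_set y A) / 2"
    using L2_set_triangle_ineq[of x y A] by simp
  have sq: "(L2_set z A)\<^sup>2 = (\<Sum>i\<in>A. (z i)\<^sup>2)" for z :: "'a \<Rightarrow> real"
    by (simp add: L2_set_def sum_nonneg)
  have "(\<Sum>i\<in>A. ((x i + y i) / 2)\<^sup>2) = (\<Sum>i\<in>A. (x i)\<^sup>2 / 2 + (y i)\<^sup>2 / 2 - (x i - y i)\<^sup>2 / 4)"
    by (intro sum.cong refl) (simp add: power2_eq_square field_simps)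
  also have "\<dots> = ((\<Sum>i\<in>A. (x i)\<^sup>2) + (\<Sum>i\<in>A. (y i)\<^sup>2)) / 2 - (\<Sum>i\<in>A. (x i - y i)\<^sup>2) / 4"
    by (simp add: sum.distrib sum_subtractf sum_divide_distrib add_divide_distrib)
  finally show "(L2_set (\<lambda>i. (x i + y i) / 2) A)\<^sup>2 =
      ((L2_set x A)\<^sup>2 + (L2_set y A)\<^sup>2) / 2 - (L2_set (\<lambda>i. x i - y i) A)\<^sup>2 / 4"
    by (simp only: sq)
qed

lemma blockpow_uniform_convexity:
  assumes p: "1 < p" "p \<le> 2"
  shows "blockpow p m k (\<lambda>i. x i - y i) \<le> (blockpow p m k x + blockpow p m k y) / 16 +
    40 / (p * (p - 1)) * ((blockpow p m k x + blockpow p m k y) / 2 - blockpow p m k (\<lambda>i. (x i + y i) / 2))"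
proof -
  let ?X = "\<lambda>j. L2_set x (block k j) powr p" and ?Y = "\<lambda>j. L2_set y (block k j) powr p"
  let ?C = "40 / (p * (p - 1))"
  have "blockpow p m k (\<lambda>i. x i - y i) \<le>
      (\<Sum>j<m. (?X j + ?Y j) / 16 + ?C * ((?X j + ?Y j) / 2 - L2_set (\<lambda>i. (x i + y i) / 2) (block k j) powr p))"
    unfolding blockpow_def
    by (intro sum_mono block_uniform_convexity p L2_set_nonneg L2_set_midpoint)
  also have "\<dots> = (blockpow p m k x + blockpow p m k y) / 16 +
      ?C * ((blockpow p m k x + blockpow p m k y) / 2 - blockpow p m k (\<lambda>i. (x i + y i) / 2))"
    unfolding blockpow_def
    by (simp only: sum.distrib sum_subtractf sum_divide_distrib[symmetric] sum_distrib_left[symmetric])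
  finally show ?thesis .
qed

definition lens_ratio :: "real \<Rightarrow> real" where
  "lens_ratio p = (1 - p * (p - 1) / 320) powr (1 / p)"

text \<open>The upper bound yields \<open>c < 2\<close> in the theorem. The lower bound makes
  \<open>2 * lens_ratio p\<close> exceed 1, which also covers close centres in
  \<open>lens_measure_le\<close>.\<close>

lemma lens_ratio_bounds:
  assumes p: "1 < p" "p \<le> 2"
  shows "1 / 2 < lens_ratio p" "lens_ratio p < 1"
proof -
  have q: "0 < p * (p - 1)" "p * (p - 1) \<le> 2"
    using p mult_mono[of p 2 "p - 1" 1] by auto
  let ?t = "1 - p * (p - 1) / 320"
  have t: "0 < ?t" "?t < 1" "1 / 2 < ?t"
    using q by auto
  have "?t powr 1 \<le> ?t powr (1 / p)"
    using p t by (intro powr_mono') auto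
  with t show "1 / 2 < lens_ratio p"
    by (simp add: lens_ratio_def)
  show "lens_ratio p < 1"
    unfolding lens_ratio_def using p t powr_less_mono2[of "1 / p" ?t 1] by simp
qed

text \<open>Uniform convexity is applied to \<open>y\<close> and \<open>y - u\<close>, whose
  difference is \<open>u\<close> and whose midpoint is \<open>y - u / 2\<close>. Since
  \<open>p \<le> 2\<close>, the difference contributes at least a quarter of
  \<open>R powr p\<close>; an eighth is lost to the error term, and the other eighth divided by the
  factor 40 gives the 320 in \<open>lens_ratio\<close>.\<close>

lemma lens_subset_ball:
  assumes p: "1 < p" "p \<le> 2" and R: "0 \<le> R"
    and y: "blocknorm p m k y \<le> R" "blocknorm p m k (\<lambda>i. y i - u i) \<le> R"
    and u: "R / 2 \<le> blocknorm p m k u"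
  shows "blocknorm p m k (\<lambda>i. y i - u i / 2) \<le> lens_ratio p * R"
proof -
  let ?P = "blockpow p m k" and ?C = "40 / (p * (p - 1))"
  have q: "0 < p * (p - 1)" "p * (p - 1) \<le> 2"
    using p mult_mono[of p 2 "p - 1" 1] by auto
  have y': "?P y \<le> R powr p" "?P (\<lambda>i. y i - u i) \<le> R powr p"
    using y p R by (simp_all add: blocknorm_le_iff)
  have "R powr p / 4 \<le> R powr p / 2 powr p"
    using p R powr_mono[of p 2 2] by (intro divide_left_mono) auto
  also have "\<dots> = (R / 2) powr p"
    using R by (simp add: powr_divide)
  also have "\<dots> \<le> blocknorm p m k u powr p"
    using u p R by (intro powr_mono2) auto
  also have "\<dots> = ?P u"
    using p by (simp add: blocknorm_powr)
  also have "\<dots> = ?P (\<lambda>i. y i - (y i - u i))"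
    by simp
  also have "\<dots> \<le> (?P y + ?P (\<lambda>i. y i - u i)) / 16 +
      ?C * ((?P y + ?P (\<lambda>i. y i - u i)) / 2 - ?P (\<lambda>i. (y i + (y i - u i)) / 2))"
    by (rule blockpow_uniform_convexity[OF p])
  also have "(\<lambda>i. (y i + (y i - u i)) / 2) = (\<lambda>i. y i - u i / 2)"
    by (auto simp: field_simps)
  also have "(?P y + ?P (\<lambda>i. y i - u i)) / 16 +
      ?C * ((?P y + ?P (\<lambda>i. y i - u i)) / 2 - ?P (\<lambda>i. y i - u i / 2)) \<le>
      (R powr p + R powr p) / 16 + ?C * ((R powr p + R powr p) / 2 - ?P (\<lambda>i. y i - u i / 2))"
    using y' q by (intro add_mono mult_left_mono divide_right_mono diff_right_mono) auto
  also have "\<dots> = R powr p / 8 + ?C * (R powr p - ?P (\<lambda>i. y i - u i / 2))"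
    by simp
  finally have "R powr p / 8 \<le> ?C * (R powr p - ?P (\<lambda>i. y i - u i / 2))"
    by argo
  then have "p * (p - 1) * (R powr p / 8) \<le> p * (p - 1) * (?C * (R powr p - ?P (\<lambda>i. y i - u i / 2)))"
    using q by (intro mult_left_mono) auto
  also have "\<dots> = 40 * (R powr p - ?P (\<lambda>i. y i - u i / 2))"
    using p by simp
  finally have "?P (\<lambda>i. y i - u i / 2) \<le> (1 - p * (p - 1) / 320) * R powr p"
    unfolding left_diff_distrib[of 1] by argo
  also have "\<dots> = (lens_ratio p * R) powr p"
    using p q R by (simp add: lens_ratio_def powr_mult powr_powr)
  finally show ?thesis
    using p R lens_ratio_bounds[OF p] by (subst blocknorm_le_iff) auto
qed

section \<open>Block structure and comparison with coordinates\<close>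

lemma valid_blocks_mono:
  assumes "valid_blocks n m k" "i \<le> j" "j \<le> m"
  shows "k i \<le> k j"
  using assms(2,3)
proof (induction j rule: dec_induct)
  case (step j)
  then show ?case
    using assms(1) by (auto simp: valid_blocks_def Suc_le_eq intro: order.trans less_imp_le)
qed simp

lemma block_subset: "valid_blocks n m k \<Longrightarrow> j < m \<Longrightarrow> block k j \<subseteq> {..<n}"
  using valid_blocks_mono[of n m k "Suc j" m] by (auto simp: block_def valid_blocks_def)

lemma valid_blocks_index_le:
  assumes "valid_blocks n m k" "j \<le> m"
  shows "j \<le> k j"
  using assms(2)
proof (induction j)
  case (Suc j)
  then have "k j < k (Suc j)"
    using assms(1) by (auto simp: valid_blocks_def)
  with Suc show ?case by simp
qed simp

lemma valid_blocks_le: "valid_blocks n m k \<Longrightarrow> m \<le> n"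
  using valid_blocks_index_le[of n m k m] by (simp add: valid_blocks_def)

lemma valid_blocks_cover:
  assumes "valid_blocks n m k" "i < n"
  obtains j where "j < m" "i \<in> block k j"
proof -
  have "i < k j \<Longrightarrow> j \<le> m \<Longrightarrow> \<exists>j'<m. i \<in> block k j'" for j
  proof (induction j)
    case 0
    then show ?case using assms by (simp add: valid_blocks_def)
  next
    case (Suc j)
    show ?case
    proof (cases "i < k j")
      case False
      with Suc.prems show ?thesis
        by (auto simp: block_def intro!: exI[of _ j])
    qed (use Suc in auto)
  qed
  from this[of m] assms that show thesis
    by (auto simp: valid_blocks_def)
qed

lemma blockpow_cong:
  assumes "valid_blocks n m k" "\<And>i. i < n \<Longrightarrow> x i = y i"
  shows "blockpow p m k x = blockpow p m k y"
  unfolding blockpow_def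
  using assms block_subset[OF assms(1)]
  by (intro sum.cong refl arg_cong[where f = "\<lambda>t. t powr p"] L2_set_cong) auto

lemma blocknorm_cong:
  assumes "valid_blocks n m k" "\<And>i. i < n \<Longrightarrow> x i = y i"
  shows "blocknorm p m k x = blocknorm p m k y"
  using blockpow_cong[OF assms] by (simp add: blocknorm_eq)

lemma abs_le_blocknorm:
  assumes "valid_blocks n m k" "0 < p" "i < n"
  shows "\<bar>x i\<bar> \<le> blocknorm p m k x"
proof -
  obtain j where j: "j < m" "i \<in> block k j"
    using valid_blocks_cover assms by blast
  have "\<bar>x i\<bar> powr p \<le> L2_set x (block k j) powr p"
    using j assms member_le_L2_set[of "block k j" i "\<lambda>i. \<bar>x i\<bar>"]
    by (intro powr_mono2) (auto simp: block_def L2_set_def)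
  also have "\<dots> \<le> blockpow p m k x"
    unfolding blockpow_def using j by (intro member_le_sum) auto
  also have "\<dots> = blocknorm p m k x powr p"
    using assms by (simp add: blocknorm_powr)
  finally show ?thesis
    using assms by (simp add: blocknorm_nonneg powr_le_powr_iff)
qed

text \<open>A cube inside the unit ball, which gives it positive volume. Each block has length at
  most \<open>n * (1 / n\<^sup>2) = 1 / n\<close>, its p-th power is no larger, and there are at
  most \<open>n\<close> blocks.\<close>

lemma blocknorm_le_of_small_coordinates:
  assumes v: "valid_blocks n m k" and p: "1 < p" and small: "\<And>i. i < n \<Longrightarrow> \<bar>x i\<bar> \<le> 1 / (real n)\<^sup>2"
  shows "blocknorm p m k x \<le> 1"
proof -
  have "0 < m"
    using v by (simp add: valid_blocks_def)
  then have n: "0 < n"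
    using valid_blocks_le[OF v] by simp
  have "L2_set x (block k j) powr p \<le> 1 / n" if "j < m" for j
  proof -
    have "L2_set x (block k j) \<le> (\<Sum>i\<in>block k j. \<bar>x i\<bar>)"
      by (rule L2_set_le_sum_abs)
    also have "\<dots> \<le> (\<Sum>i<n. \<bar>x i\<bar>)"
      using block_subset[OF v that] by (intro sum_mono2) auto
    also have "\<dots> \<le> (\<Sum>i<n. 1 / (real n)\<^sup>2)"
      by (intro sum_mono small) auto
    also have "\<dots> = 1 / n"
      using n by (simp add: power2_eq_square)
    finally have le: "L2_set x (block k j) \<le> 1 / n" .
    have "L2_set x (block k j) powr p \<le> (1 / n) powr p"
      using le p by (intro powr_mono2) (auto simp: L2_set_nonneg)
    also have "\<dots> \<le> (1 / n) powr 1"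
      using n p by (intro powr_mono') auto
    finally show ?thesis by simp
  qed
  then have "blockpow p m k x \<le> (\<Sum>j<m. 1 / n)"
    unfolding blockpow_def by (intro sum_mono) auto
  also have "\<dots> \<le> 1"
    using n valid_blocks_le[OF v] by simp
  finally show ?thesis
    using p by (simp add: blocknorm_le_iff)
qed

section \<open>Volumes of superballs\<close>

lemma emeasure_PiM_lborel_affine:
  fixes a :: "nat \<Rightarrow> real" and c :: real
  assumes c: "0 < c" and X: "X \<in> sets (Pi\<^sub>M {..<n} (\<lambda>_. lborel))"
  shows "emeasure (Pi\<^sub>M {..<n} (\<lambda>_. lborel)) X = ennreal (c ^ n) *
    emeasure (Pi\<^sub>M {..<n} (\<lambda>_. lborel))
      {y \<in> space (Pi\<^sub>M {..<n} (\<lambda>_. lborel)). (\<lambda>i\<in>{..<n}. a i + c * y i) \<in> X}"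
proof -
  let ?P = "Pi\<^sub>M {..<n} (\<lambda>_. lborel :: real measure)"
  interpret product_sigma_finite "\<lambda>_::nat. lborel :: real measure"
    by standard
  define T where "T y = (\<lambda>i\<in>{..<n}. a i + c * y i)" for y :: "nat \<Rightarrow> real"
  have T[measurable]: "T \<in> ?P \<rightarrow>\<^sub>M ?P"
    unfolding T_def by measurable
  have "density (distr ?P ?P T) (\<lambda>_. ennreal (c ^ n)) = ?P"
  proof (rule PiM_eqI)
    fix A :: "nat \<Rightarrow> real set" assume A: "\<And>i. i \<in> {..<n} \<Longrightarrow> A i \<in> sets lborel"
    have A': "(\<lambda>t. a i + c * t) -` A i \<in> sets borel" if "i < n" for i
      using A[of i] that measurable_sets[of "\<lambda>t. a i + c * t" borel borel "A i"] by simp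
    have factor: "emeasure lborel (A i) = ennreal c * emeasure lborel ((\<lambda>t. a i + c * t) -` A i)"
      if "i < n" for i
    proof -
      have "emeasure lborel (A i) =
          emeasure (density (distr lborel borel (\<lambda>t. a i + c * t)) (\<lambda>_. ennreal \<bar>c\<bar>)) (A i)"
        using c lborel_real_affine[of c "a i"] by simp
      also have "\<dots> = ennreal c * emeasure lborel ((\<lambda>t. a i + c * t) -` A i)"
        using A[of i] that c by (simp add: emeasure_density nn_integral_cmult_indicator emeasure_distr)
      finally show ?thesis .
    qed
    have vim: "T -` Pi\<^sub>E {..<n} A \<inter> space ?P = Pi\<^sub>E {..<n} (\<lambda>i. (\<lambda>t. a i + c * t) -` A i)"
      by (auto simp: T_def space_PiM PiE_iff)
    have "Pi\<^sub>E {..<n} A \<in> sets ?P"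
      using A by (intro sets_PiM_I_finite) auto
    then have "emeasure (density (distr ?P ?P T) (\<lambda>_. ennreal (c ^ n))) (Pi\<^sub>E {..<n} A) =
        ennreal (c ^ n) * emeasure ?P (Pi\<^sub>E {..<n} (\<lambda>i. (\<lambda>t. a i + c * t) -` A i))"
      by (simp add: emeasure_density nn_integral_cmult_indicator emeasure_distr vim)
    also have "\<dots> = (\<Prod>i<n. ennreal c) * (\<Prod>i<n. emeasure lborel ((\<lambda>t. a i + c * t) -` A i))"
      using A' c by (subst emeasure_PiM) (auto simp: ennreal_power)
    also have "\<dots> = (\<Prod>i<n. emeasure lborel (A i))"
      by (simp add: prod.distrib[symmetric] factor del: prod_constant)
    finally show "emeasure (density (distr ?P ?P T) (\<lambda>_. ennreal (c ^ n))) (Pi\<^sub>E {..<n} A) =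
        (\<Prod>i\<in>{..<n}. emeasure lborel (A i))" .
  qed simp_all
  then have "emeasure ?P X = emeasure (density (distr ?P ?P T) (\<lambda>_. ennreal (c ^ n))) X"
    by simp
  also have "\<dots> = ennreal (c ^ n) * emeasure ?P (T -` X \<inter> space ?P)"
    using X by (simp add: emeasure_density nn_integral_cmult_indicator emeasure_distr)
  finally show ?thesis
    by (simp add: T_def vimage_def Int_def conj_commute)
qed

lemma space_lebn [simp]: "space (lebn n) = Pi\<^sub>E {..<n} (\<lambda>_. UNIV)"
  by (simp add: lebn_def space_PiM)

lemma sigma_finite_completion:
  assumes "sigma_finite_measure M"
  shows "sigma_finite_measure (completion M)"
proof -
  interpret sigma_finite_measure M
    by fact
  obtain A where "countable A" "A \<subseteq> sets M" "\<Union>A = space M" "\<forall>a\<in>A. emeasure M a \<noteq> \<infinity>"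
    using sigma_finite_countable by blast
  then show ?thesis
    by (intro sigma_finite_measure.intro exI[of _ A]) (auto simp: subset_iff)
qed

lemma sigma_finite_lebn: "sigma_finite_measure (lebn n)"
proof -
  interpret product_sigma_finite "\<lambda>_::nat. lborel :: real measure"
    by standard
  show ?thesis
    unfolding lebn_def by (intro sigma_finite_completion sigma_finite) simp
qed

lemma emeasure_lebn_bounded:
  assumes S: "S \<in> sets (lebn n)" and B: "\<And>x i. x \<in> S \<Longrightarrow> i < n \<Longrightarrow> \<bar>x i\<bar> \<le> B"
  shows "emeasure (lebn n) S < top"
proof -
  interpret product_sigma_finite "\<lambda>_::nat. lborel :: real measure"
    by standard
  let ?box = "Pi\<^sub>E {..<n} (\<lambda>_. {- B..B :: real})"
  have box: "?box \<in> sets (Pi\<^sub>M {..<n} (\<lambda>_. lborel))"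
    by (intro sets_PiM_I_finite) auto
  have "S \<subseteq> ?box"
  proof
    fix x assume x: "x \<in> S"
    then have "x \<in> extensional {..<n}"
      using sets.sets_into_space[OF S] by (auto simp: PiE_iff)
    moreover have "x i \<in> {- B..B}" if "i < n" for i
      using B[OF x that] by auto
    ultimately show "x \<in> ?box"
      by (simp add: PiE_iff)
  qed
  then have "emeasure (lebn n) S \<le> emeasure (lebn n) ?box"
    using box by (intro emeasure_mono) (auto simp: lebn_def)
  also have "\<dots> = emeasure (Pi\<^sub>M {..<n} (\<lambda>_. lborel)) ?box"
    using box by (simp add: lebn_def)
  also have "\<dots> < top"
    by (subst emeasure_PiM) (auto simp: less_top[symmetric] ennreal_prod_eq_top emeasure_lborel_Icc_eq simp del: prod_constant)
  finally show ?thesis .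
qed

lemma measurable_lebn_component:
  assumes "f \<in> N \<rightarrow>\<^sub>M lebn n" "i < n"
  shows "(\<lambda>w. f w i) \<in> borel_measurable N"
proof -
  have "(\<lambda>x. x i) \<in> lebn n \<rightarrow>\<^sub>M borel"
    unfolding lebn_def using assms(2) by (intro measurable_completion) simp
  from measurable_compose[OF assms(1) this] show ?thesis .
qed

lemma measurable_blocknorm:
  assumes v: "valid_blocks n m k" and [measurable]: "\<And>i. i < n \<Longrightarrow> (\<lambda>w. x w i) \<in> borel_measurable N"
  shows "(\<lambda>w. blocknorm p m k (x w)) \<in> borel_measurable N"
proof -
  have [measurable]: "(\<lambda>w. x w i) \<in> borel_measurable N" if "j < m" "i \<in> {k j..<k (Suc j)}" for i j
    using block_subset[OF v that(1)] that(2) by (auto simp: block_def)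
  show ?thesis
    unfolding blocknorm_def by measurable
qed

lemma measurable_sdist:
  assumes v: "valid_blocks n m k" and "f \<in> N \<rightarrow>\<^sub>M lebn n" "g \<in> N \<rightarrow>\<^sub>M lebn n"
  shows "(\<lambda>w. sdist p m k (f w) (g w)) \<in> borel_measurable N"
  unfolding sdist_def
  by (intro measurable_blocknorm[OF v] borel_measurable_diff) (simp_all add: measurable_lebn_component[OF assms(2)] measurable_lebn_component[OF assms(3)])

lemma superball_eq:
  "superball p m k n x r = {y \<in> space (Pi\<^sub>M {..<n} (\<lambda>_. lborel)). blocknorm p m k (\<lambda>i. y i - x i) \<le> r}"
  by (simp add: superball_def sdist_def space_PiM)

lemma superball_sets:
  assumes "valid_blocks n m k"
  shows "superball p m k n x r \<in> sets (Pi\<^sub>M {..<n} (\<lambda>_. lborel))"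
proof -
  have [measurable]: "(\<lambda>y. blocknorm p m k (\<lambda>i. y i - x i)) \<in> borel_measurable (Pi\<^sub>M {..<n} (\<lambda>_. lborel))"
    using measurable_component_singleton[of _ "{..<n}" "\<lambda>_. lborel :: real measure"]
    by (intro measurable_blocknorm[OF assms] borel_measurable_diff) auto
  show ?thesis
    unfolding superball_eq by measurable
qed

lemma superball_sets_lebn: "valid_blocks n m k \<Longrightarrow> superball p m k n x r \<in> sets (lebn n)"
  unfolding lebn_def by (intro sets_completionI_sets superball_sets)

lemma emeasure_superball_scale:
  assumes v: "valid_blocks n m k" and p: "0 < p" and r: "0 < r"
  shows "emeasure (lebn n) (superball p m k n x r) =
    ennreal (r ^ n) * emeasure (lebn n) (superball p m k n (\<lambda>_. 0) 1)"
proof -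
  let ?P = "Pi\<^sub>M {..<n} (\<lambda>_. lborel :: real measure)"
  have "blocknorm p m k (\<lambda>i. (\<lambda>i\<in>{..<n}. x i + r * y i) i - x i) = r * blocknorm p m k y" for y
    using blocknorm_cong[OF v, of "\<lambda>i. (\<lambda>i\<in>{..<n}. x i + r * y i) i - x i" "\<lambda>i. r * y i"]
      blocknorm_scale[OF p, of m k r y] r by simp
  then have "{y \<in> space ?P. (\<lambda>i\<in>{..<n}. x i + r * y i) \<in> superball p m k n x r} =
      superball p m k n (\<lambda>_. 0) 1"
    using r by (auto simp: superball_eq space_PiM)
  then show ?thesis
    using emeasure_PiM_lborel_affine[OF r superball_sets[OF v], of p x r x] superball_sets[OF v]
    by (simp add: lebn_def)
qed

lemma emeasure_unit_superball:
  assumes v: "valid_blocks n m k" and p: "1 < p"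
  shows "0 < emeasure (lebn n) (superball p m k n (\<lambda>_. 0) 1)"
    and "emeasure (lebn n) (superball p m k n (\<lambda>_. 0) 1) < top"
proof -
  let ?P = "Pi\<^sub>M {..<n} (\<lambda>_. lborel :: real measure)"
  let ?box = "\<lambda>\<delta>. Pi\<^sub>E {..<n} (\<lambda>_. {- \<delta>..\<delta> :: real})"
  interpret product_sigma_finite "\<lambda>_::nat. lborel :: real measure"
    by standard
  have n: "0 < n"
    using v valid_blocks_le[OF v] by (simp add: valid_blocks_def)
  have box: "emeasure ?P (?box \<delta>) = ennreal ((2 * \<delta>) ^ n)" if "0 < \<delta>" for \<delta>
    using that by (subst emeasure_PiM) (auto simp: ennreal_power)
  have box_sets: "?box \<delta> \<in> sets ?P" for \<delta>
    by (intro sets_PiM_I_finite) auto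
  let ?\<delta> = "1 / (real n)\<^sup>2"
  have "0 < ennreal ((2 * ?\<delta>) ^ n)"
    using n by simp
  also have "\<dots> = emeasure ?P (?box ?\<delta>)"
    using n by (intro box[symmetric]) simp
  also have "\<dots> \<le> emeasure ?P (superball p m k n (\<lambda>_. 0) 1)"
  proof (intro emeasure_mono superball_sets v subsetI)
    fix y assume y: "y \<in> ?box ?\<delta>"
    then have "\<bar>y i\<bar> \<le> ?\<delta>" if "i < n" for i
      using that by (auto simp: PiE_iff abs_le_iff minus_le_iff)
    then show "y \<in> superball p m k n (\<lambda>_. 0) 1"
      using y blocknorm_le_of_small_coordinates[OF v p] by (simp add: superball_eq space_PiM PiE_iff)
  qed
  finally show "0 < emeasure (lebn n) (superball p m k n (\<lambda>_. 0) 1)"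
    using superball_sets[OF v] by (simp add: lebn_def)
  have "superball p m k n (\<lambda>_. 0) 1 \<subseteq> ?box 1"
  proof
    fix y assume y: "y \<in> superball p m k n (\<lambda>_. 0) 1"
    have "\<bar>y i\<bar> \<le> 1" if "i < n" for i
      using abs_le_blocknorm[OF v _ that, of p y] p y by (auto simp: superball_eq)
    then show "y \<in> ?box 1"
      using y by (auto simp: superball_eq space_PiM PiE_iff abs_le_iff)
  qed
  then have "emeasure ?P (superball p m k n (\<lambda>_. 0) 1) \<le> emeasure ?P (?box 1)"
    by (intro emeasure_mono box_sets)
  also have "\<dots> < top"
    by (subst box) auto
  finally show "emeasure (lebn n) (superball p m k n (\<lambda>_. 0) 1) < top"
    using superball_sets[OF v] by (simp add: lebn_def)
qed

text \<open>The volume of a ball is its radius to the n-th power times that of the unit ball, which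
  is positive and finite. So exactly one radius gives volume 1 and the definite description in
  \<open>rad\<close> denotes it.\<close>

lemma rad:
  assumes v: "valid_blocks n m k" and p: "1 < p"
  shows "0 < rad p m k n" "emeasure (lebn n) (superball p m k n (\<lambda>_. 0) (rad p m k n)) = 1"
proof -
  let ?good = "\<lambda>r. 0 < r \<and> emeasure (lebn n) (superball p m k n (\<lambda>_. 0) r) = 1"
  have n: "0 < n"
    using v valid_blocks_le[OF v] by (simp add: valid_blocks_def)
  obtain V where V: "emeasure (lebn n) (superball p m k n (\<lambda>_. 0) 1) = ennreal V" "0 < V"
    using emeasure_unit_superball[OF v p]
    by (cases "emeasure (lebn n) (superball p m k n (\<lambda>_. 0) 1)") auto
  have good_iff: "?good r \<longleftrightarrow> 0 < r \<and> r ^ n = 1 / V" for r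
    using emeasure_superball_scale[OF v, of p r "\<lambda>_. 0"] p V
    by (auto simp: ennreal_mult[symmetric] field_simps)
  have "\<exists>!r. ?good r"
    unfolding good_iff
  proof (rule ex1I)
    show "0 < root n (1 / V) \<and> root n (1 / V) ^ n = 1 / V"
      using n V by simp
  next
    fix r assume "0 < r \<and> r ^ n = 1 / V"
    then show "r = root n (1 / V)"
      using n by (metis less_imp_le real_root_power_cancel)
  qed
  from theI'[OF this] show "0 < rad p m k n" "emeasure (lebn n) (superball p m k n (\<lambda>_. 0) (rad p m k n)) = 1"
    by (auto simp: rad_def)
qed

lemma emeasure_superball:
  assumes v: "valid_blocks n m k" and p: "1 < p" and s: "0 < s"
  shows "emeasure (lebn n) (superball p m k n x (s * rad p m k n)) = ennreal (s ^ n)"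
proof -
  have "emeasure (lebn n) (superball p m k n x (s * rad p m k n)) =
      ennreal (s ^ n) * (ennreal (rad p m k n ^ n) * emeasure (lebn n) (superball p m k n (\<lambda>_. 0) 1))"
    using p s rad(1)[OF v p]
    by (subst emeasure_superball_scale[OF v]) (auto simp: power_mult_distrib ennreal_mult mult.assoc)
  also have "ennreal (rad p m k n ^ n) * emeasure (lebn n) (superball p m k n (\<lambda>_. 0) 1) = 1"
    using rad[OF v p] p by (subst emeasure_superball_scale[OF v, symmetric]) auto
  finally show ?thesis by simp
qed

lemma sdist_commute: "0 < p \<Longrightarrow> sdist p m k x y = sdist p m k y x"
  using blocknorm_scale[of p m k "-1" "\<lambda>i. x i - y i"] by (simp add: sdist_def)

text \<open>If \<open>x\<close> is within \<open>rad\<close> of \<open>w\<close>, the set lies in a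
  ball of radius \<open>rad\<close> and has volume at most 1. Otherwise the two centres are at least
  half of \<open>2 * rad\<close> apart, as \<open>lens_subset_ball\<close> requires, and the ball
  around their midpoint contains the set.\<close>

lemma lens_measure_le:
  assumes v: "valid_blocks n m k" and p: "1 < p" "p \<le> 2"
    and x: "sdist p m k w x \<le> 2 * rad p m k n"
  shows "emeasure (lebn n)
    {y \<in> space (lebn n). sdist p m k w y \<le> sdist p m k w x \<and> sdist p m k x y \<le> 2 * rad p m k n}
    \<le> ennreal ((2 * lens_ratio p) ^ n)"
proof -
  let ?r = "rad p m k n" and ?c = "2 * lens_ratio p"
  note lr = lens_ratio_bounds[OF p] and r = rad(1)[OF v p(1)]
  define z s where "z = (if sdist p m k w x \<le> ?r then w else (\<lambda>i. (w i + x i) / 2))"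
    and "s = (if sdist p m k w x \<le> ?r then 1 else ?c)"
  have "{y \<in> space (lebn n). sdist p m k w y \<le> sdist p m k w x \<and> sdist p m k x y \<le> 2 * ?r}
      \<subseteq> superball p m k n z (s * ?r)"
  proof safe
    fix y assume y: "y \<in> space (lebn n)" "sdist p m k w y \<le> sdist p m k w x" "sdist p m k x y \<le> 2 * ?r"
    have "sdist p m k z y \<le> s * ?r"
    proof (cases "sdist p m k w x \<le> ?r")
      case True
      with y show ?thesis by (simp add: z_def s_def)
    next
      case False
      have "blocknorm p m k (\<lambda>i. (y i - w i) - (x i - w i) / 2) \<le> lens_ratio p * (2 * ?r)"
        using y x False r by (intro lens_subset_ball p) (auto simp: sdist_def)
      also have "(\<lambda>i. (y i - w i) - (x i - w i) / 2) = (\<lambda>i. y i - (w i + x i) / 2)"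
        by (auto simp: field_simps)
      finally show ?thesis
        using False by (simp add: z_def s_def sdist_def mult_ac)
    qed
    with y show "y \<in> superball p m k n z (s * ?r)"
      by (simp add: superball_def)
  qed
  then have "emeasure (lebn n)
      {y \<in> space (lebn n). sdist p m k w y \<le> sdist p m k w x \<and> sdist p m k x y \<le> 2 * ?r}
      \<le> emeasure (lebn n) (superball p m k n z (s * ?r))"
    by (intro emeasure_mono superball_sets_lebn v)
  also have "\<dots> = ennreal (s ^ n)"
    using lr by (intro emeasure_superball v p) (auto simp: s_def)
  also have "\<dots> \<le> ennreal (?c ^ n)"
    using lr by (intro ennreal_leI power_mono) (auto simp: s_def)
  finally show ?thesis .
qed

section \<open>The hard superball model\<close>

text \<open>The factors \<open>t - N\<close> and \<open>q ^ t - q powr N\<close> always have the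
  same sign. With \<open>N\<close> the mean at \<open>x\<close>, the deviations from
  \<open>N\<close> sum to 0 at \<open>x\<close>, hence to a nonnegative number at
  \<open>y\<close>.\<close>

lemma power_series_mean_mono:
  fixes a :: "nat \<Rightarrow> real"
  assumes a: "\<And>t. 0 \<le> a t" "0 < a 0"
    and summ: "\<And>x. 0 < x \<Longrightarrow> summable (\<lambda>t. a t * x ^ t)" "\<And>x. 0 < x \<Longrightarrow> summable (\<lambda>t. real t * (a t * x ^ t))"
    and x: "0 < x" "x \<le> y"
  shows "(\<Sum>t. real t * (a t * x ^ t)) / (\<Sum>t. a t * x ^ t) \<le> (\<Sum>t. real t * (a t * y ^ t)) / (\<Sum>t. a t * y ^ t)"
proof -
  let ?Z = "\<lambda>x. \<Sum>t. a t * x ^ t" and ?A = "\<lambda>x. \<Sum>t. real t * (a t * x ^ t)"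
  define N where "N = ?A x / ?Z x"
  have Z_pos: "0 < ?Z x" if "0 < x" for x
    using a that by (intro suminf_pos2[of _ 0] summ) auto
  have split: "(\<lambda>t. (real t - N) * (a t * x ^ t)) sums (?A x - N * ?Z x)" if "0 < x" for x
    using sums_diff[OF summable_sums[OF summ(2)[OF that]] sums_mult[OF summable_sums[OF summ(1)[OF that]], of N]]
    by (simp add: left_diff_distrib)
  define q where "q = y / x"
  have q: "1 \<le> q" "y = q * x"
    using x by (auto simp: q_def)
  have "q powr N * ((real t - N) * (a t * x ^ t)) \<le> (real t - N) * (a t * y ^ t)" for t
  proof -
    have "0 \<le> (real t - N) * (q powr real t - q powr N)"
      using q powr_mono[of N "real t" q] powr_mono[of "real t" N q]
      by (cases "N \<le> real t") (auto intro: mult_nonneg_nonneg mult_nonpos_nonpos)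
    then have "0 \<le> (real t - N) * (q ^ t - q powr N)"
      using q by (simp add: powr_realpow)
    from mult_nonneg_nonneg[OF this, of "a t * x ^ t"]
    have "0 \<le> (real t - N) * (q ^ t - q powr N) * (a t * x ^ t)"
      using a x by simp
    then show ?thesis
      by (simp add: q(2) power_mult_distrib algebra_simps)
  qed
  then have "q powr N * (?A x - N * ?Z x) \<le> ?A y - N * ?Z y"
    using x by (intro sums_le[OF _ sums_mult[OF split] split]) auto
  moreover have "?A x - N * ?Z x = 0"
    using Z_pos[of x] x by (simp add: N_def)
  ultimately show ?thesis
    using Z_pos[of y] x by (simp add: N_def pos_le_divide_eq)
qed

definition hard_core :: "real \<Rightarrow> nat \<Rightarrow> (nat \<Rightarrow> nat) \<Rightarrow> nat \<Rightarrow> (nat \<Rightarrow> real) \<Rightarrow> (nat \<Rightarrow> real) \<Rightarrow> ennreal" where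
  "hard_core p m k n x y = (if 2 * rad p m k n \<le> sdist p m k x y then 1 else 0)"

lemma prod_hard_core:
  "finite A \<Longrightarrow> (\<Prod>i\<in>A. if P i then 1 else 0 :: ennreal) = (if \<forall>i\<in>A. P i then 1 else 0)"
  by (induction A rule: finite_induct) auto

locale superballs =
  fixes p :: real and n m :: nat and k :: "nat \<Rightarrow> nat"
  assumes p: "1 < p" "p \<le> 2" and blocks: "valid_blocks n m k"
begin

abbreviation "e \<equiv> hard_core p m k n"
abbreviation "r \<equiv> rad p m k n"
abbreviation "sd \<equiv> sdist p m k"

lemma sd_commute: "sd x y = sd y x"
  using p by (simp add: sdist_commute)

sublocale repulsive_gas "lebn n" e
proof (intro repulsive_gas.intro repulsive_gas_axioms.intro)
  show "sigma_finite_measure (lebn n)"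
    by (rule sigma_finite_lebn)
  have [measurable]: "(\<lambda>w. sd (fst w) (snd w)) \<in> borel_measurable (lebn n \<Otimes>\<^sub>M lebn n)"
    by (intro measurable_sdist[OF blocks]) measurable
  show "(\<lambda>(x, y). e x y) \<in> borel_measurable (lebn n \<Otimes>\<^sub>M lebn n)"
    unfolding hard_core_def case_prod_beta by measurable
qed (auto simp: hard_core_def sd_commute)

lemma measurable_sd [measurable (raw)]:
  "f \<in> N \<rightarrow>\<^sub>M lebn n \<Longrightarrow> g \<in> N \<rightarrow>\<^sub>M lebn n \<Longrightarrow> (\<lambda>w. sd (f w) (g w)) \<in> borel_measurable N"
  by (rule measurable_sdist[OF blocks])

lemma excluded_volume:
  assumes \<tau>: "\<And>v. \<tau> v \<le> L" and x: "x \<in> space (lebn n)"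
  shows "(\<integral>\<^sup>+v. \<tau> v * (1 - e v x) \<partial>lebn n) \<le> 2 ^ n * L"
proof -
  have "(\<integral>\<^sup>+v. \<tau> v * (1 - e v x) \<partial>lebn n) \<le> (\<integral>\<^sup>+v. L * indicator (superball p m k n x (2 * r)) v \<partial>lebn n)"
  proof (rule nn_integral_mono)
    fix v assume "v \<in> space (lebn n)"
    then show "\<tau> v * (1 - e v x) \<le> L * indicator (superball p m k n x (2 * r)) v"
      using \<tau>[of v] by (auto simp: hard_core_def superball_def sd_commute[of v] not_le split: split_indicator)
  qed
  also have "\<dots> = L * ennreal (2 ^ n)"
    using superball_sets_lebn[OF blocks]
    by (simp add: nn_integral_cmult_indicator emeasure_superball[OF blocks p(1)])
  finally show ?thesis
    by (simp add: mult.commute flip: ennreal_power)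
qed

text \<open>By symmetry it suffices to integrate over the pairs whose second point is the one closer to the
  centre \<open>w\<close>; these second points lie in a lens.\<close>
lemma local_overlap:
  assumes \<tau>[measurable]: "\<tau> \<in> borel_measurable (lebn n)" and w[measurable]: "w \<in> space (lebn n)"
    and le: "\<And>x. \<tau> x \<le> L * (1 - e w x)"
  shows "(\<integral>\<^sup>+x. \<tau> x * (\<integral>\<^sup>+y. \<tau> y * (1 - e x y) \<partial>lebn n) \<partial>lebn n) \<le>
    2 * (L * ennreal ((2 * lens_ratio p) ^ n)) * (\<integral>\<^sup>+x. \<tau> x \<partial>lebn n)"
proof -
  interpret P: pair_sigma_finite "lebn n" "lebn n"
    by standard
  let ?c = "ennreal ((2 * lens_ratio p) ^ n)"
  define closer :: "(nat \<Rightarrow> real) \<Rightarrow> (nat \<Rightarrow> real) \<Rightarrow> ennreal"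
    where "closer x y = (if sd w y \<le> sd w x then 1 else 0)" for x y
  define F where "F x y = \<tau> x * (\<tau> y * (1 - e x y) * closer x y)" for x y
  have closer[measurable]: "(\<lambda>(x, y). closer x y) \<in> borel_measurable (lebn n \<Otimes>\<^sub>M lebn n)"
    unfolding closer_def case_prod_beta by measurable
  have F[measurable]: "(\<lambda>(x, y). F x y) \<in> borel_measurable (lebn n \<Otimes>\<^sub>M lebn n)"
    using closer unfolding F_def case_prod_beta by measurable
  have inner: "(\<integral>\<^sup>+y. F x y \<partial>lebn n) \<le> \<tau> x * (L * ?c)" if x[measurable]: "x \<in> space (lebn n)" for x
  proof (cases "sd w x \<le> 2 * r")
    case False
    \<comment> \<open>Outside the excluded ball of \<open>w\<close> the factor
      \<open>1 - e w x\<close> vanishes.\<close>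
    then have "\<tau> x = 0"
      using le[of x] by (simp add: hard_core_def)
    then show ?thesis by (simp add: F_def)
  next
    case True
    let ?lens = "{y \<in> space (lebn n). sd w y \<le> sd w x \<and> sd x y \<le> 2 * r}"
    have "(\<integral>\<^sup>+y. F x y \<partial>lebn n) \<le> (\<integral>\<^sup>+y. \<tau> x * L * indicator ?lens y \<partial>lebn n)"
    proof (rule nn_integral_mono)
      fix y assume y: "y \<in> space (lebn n)"
      have "\<tau> y \<le> L"
        using le[of y] by (auto simp: hard_core_def intro: order.trans split: if_splits)
      then have "\<tau> x * \<tau> y \<le> \<tau> x * L"
        by (rule mult_left_mono) simp
      with y show "F x y \<le> \<tau> x * L * indicator ?lens y"
        by (auto simp: F_def closer_def hard_core_def not_le split: split_indicator)
    qed
    also have "\<dots> = \<tau> x * L * emeasure (lebn n) ?lens"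
      by (rule nn_integral_cmult_indicator) measurable
    also have "\<dots> \<le> \<tau> x * L * ?c"
      by (intro mult_left_mono lens_measure_le[OF blocks p True]) simp
    finally show ?thesis
      by (simp add: mult.assoc)
  qed
  have "(\<integral>\<^sup>+x. \<tau> x * (\<integral>\<^sup>+y. \<tau> y * (1 - e x y) \<partial>lebn n) \<partial>lebn n) =
      (\<integral>\<^sup>+x. (\<integral>\<^sup>+y. \<tau> x * (\<tau> y * (1 - e x y)) \<partial>lebn n) \<partial>lebn n)"
    by (intro nn_integral_cong nn_integral_cmult[symmetric]) measurable
  \<comment> \<open>One of the two points is the closer one. Ties are counted twice, hence only an
    inequality.\<close>
  also have "\<dots> \<le> (\<integral>\<^sup>+x. (\<integral>\<^sup>+y. F x y + F y x \<partial>lebn n) \<partial>lebn n)"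
    by (intro nn_integral_mono) (auto simp: F_def closer_def e_sym mult_ac add_increasing)
  also have "\<dots> = (\<integral>\<^sup>+x. (\<integral>\<^sup>+y. F x y \<partial>lebn n) + (\<integral>\<^sup>+y. F y x \<partial>lebn n) \<partial>lebn n)"
    by (intro nn_integral_cong nn_integral_add) measurable
  also have "\<dots> = (\<integral>\<^sup>+x. (\<integral>\<^sup>+y. F x y \<partial>lebn n) \<partial>lebn n) + (\<integral>\<^sup>+x. (\<integral>\<^sup>+y. F y x \<partial>lebn n) \<partial>lebn n)"
    by (intro nn_integral_add) measurable
  also have "(\<integral>\<^sup>+x. (\<integral>\<^sup>+y. F y x \<partial>lebn n) \<partial>lebn n) = (\<integral>\<^sup>+x. (\<integral>\<^sup>+y. F x y \<partial>lebn n) \<partial>lebn n)"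
    by (rule P.Fubini'[of F]) measurable
  also have "(\<integral>\<^sup>+x. (\<integral>\<^sup>+y. F x y \<partial>lebn n) \<partial>lebn n) + (\<integral>\<^sup>+x. (\<integral>\<^sup>+y. F x y \<partial>lebn n) \<partial>lebn n) =
      2 * (\<integral>\<^sup>+x. (\<integral>\<^sup>+y. F x y \<partial>lebn n) \<partial>lebn n)"
    by (simp add: mult_2)
  also have "\<dots> \<le> 2 * (\<integral>\<^sup>+x. \<tau> x * (L * ?c) \<partial>lebn n)"
    by (intro mult_left_mono nn_integral_mono inner) auto
  also have "\<dots> = 2 * (L * ?c) * (\<integral>\<^sup>+x. \<tau> x \<partial>lebn n)"
    by (subst nn_integral_multc) (auto simp: mult_ac)
  finally show ?thesis .
qed

context
  fixes S :: "(nat \<Rightarrow> real) set" and V :: real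
  assumes S[measurable]: "S \<in> sets (lebn n)" and V: "emeasure (lebn n) S = ennreal V" "0 < V"
begin

abbreviation "activity lam \<equiv> \<lambda>x. ennreal lam * indicator S x"

lemma nn_integral_activity: "0 < lam \<Longrightarrow> (\<integral>\<^sup>+x. activity lam x \<partial>lebn n) = ennreal (lam * V)"
  using V by (simp add: nn_integral_cmult_indicator ennreal_mult)

text \<open>The link to the model: ordered hard-core configurations carry weight
  \<open>lam ^ t\<close> each, and \<open>Zhat\<close> divides their volume by
  \<open>fact t\<close>. The configuration set is already measurable before the outer completion, so
  both measures agree on it.\<close>

lemma weight_activity:
  assumes lam: "0 < lam"
  shows "weight t (activity lam) = ennreal (lam ^ t * (fact t * Zhat p m k n S t))"
proof -
  define A where "A = {xs \<in> Pi\<^sub>E {..<t} (\<lambda>_. S). \<forall>i<t. \<forall>j<t. i \<noteq> j \<longrightarrow> 2 * r \<le> sd (xs i) (xs j)}"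
  have S_space: "S \<subseteq> space (lebn n)"
    using sets.sets_into_space[OF S] .
  have A_eq: "A = {xs \<in> space (conf_measure t). (\<forall>i<t. xs i \<in> S) \<and>
      (\<forall>i<t. \<forall>j<t. i \<noteq> j \<longrightarrow> 2 * r \<le> sd (xs i) (xs j))}"
    using S_space by (auto simp: A_def space_PiM PiE_iff subset_iff)
  have A[measurable]: "A \<in> sets (conf_measure t)"
    unfolding A_eq by measurable
  have "emeasure (conf_measure t) A \<le> emeasure (conf_measure t) (Pi\<^sub>E {..<t} (\<lambda>_. S))"
    using S by (intro emeasure_mono sets_PiM_I_finite) (auto simp: A_def)
  also have "\<dots> < top"
    using V by (subst emeasure_PiM) (auto simp: ennreal_power)
  finally have A_fin: "emeasure (conf_measure t) A = ennreal (measure (conf_measure t) A)"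
    by (intro emeasure_eq_ennreal_measure) simp
  have Z: "fact t * Zhat p m k n S t = measure (conf_measure t) A"
  proof (cases "t = 0")
    \<comment> \<open>There is exactly one empty configuration, and the product measure over the
      empty index set gives it mass 1, in accordance with the convention for \<open>Zhat\<close> at
      0.\<close>
    case True
    then have "A = {\<lambda>_. undefined}"
      by (simp add: A_def)
    with True show ?thesis
      by (simp add: Zhat_def PiM_empty)
  next
    case False
    then show ?thesis
      by (simp add: Zhat_def A_def[symmetric] measure_completion)
  qed
  have "boltz t xs * (\<Prod>i<t. activity lam (xs i)) = ennreal (lam ^ t) * indicator A xs"
    if xs: "xs \<in> space (conf_measure t)" for xs
  proof -
    have "boltz t xs = (if \<forall>j\<in>{..<t}. \<forall>i\<in>{..<j}. 2 * r \<le> sd (xs i) (xs j) then 1 else 0)"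
      unfolding boltz_def hard_core_def by (simp only: prod_hard_core finite_lessThan)
    also have "(\<forall>j\<in>{..<t}. \<forall>i\<in>{..<j}. 2 * r \<le> sd (xs i) (xs j)) \<longleftrightarrow>
        (\<forall>i<t. \<forall>j<t. i \<noteq> j \<longrightarrow> 2 * r \<le> sd (xs i) (xs j))" (is "?L \<longleftrightarrow> ?R")
    proof
      assume L: ?L
      show ?R
      proof (intro allI impI)
        fix i j assume ij: "i < t" "j < t" "i \<noteq> j"
        show "2 * r \<le> sd (xs i) (xs j)"
        proof (cases "i < j")
          case False
          with ij L have "2 * r \<le> sd (xs j) (xs i)"
            by auto
          then show ?thesis
            by (simp add: sd_commute[of "xs i"])
        qed (use ij L in auto)
      qed
    qed auto
    finally have "boltz t xs = (if \<forall>i<t. \<forall>j<t. i \<noteq> j \<longrightarrow> 2 * r \<le> sd (xs i) (xs j) then 1 else 0)" .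
    moreover have "(\<Prod>i<t. indicator S (xs i)) = (if \<forall>i\<in>{..<t}. xs i \<in> S then 1 else 0 :: ennreal)"
      unfolding indicator_def of_bool_def by (rule prod_hard_core) simp
    ultimately show ?thesis
      using xs lam by (auto simp: prod.distrib A_eq ennreal_power split: split_indicator)
  qed
  then have "weight t (activity lam) = (\<integral>\<^sup>+xs. ennreal (lam ^ t) * indicator A xs \<partial>conf_measure t)"
    unfolding weight_def by (rule nn_integral_cong)
  also have "\<dots> = ennreal (lam ^ t) * emeasure (conf_measure t) A"
    by (rule nn_integral_cmult_indicator) measurable
  also have "\<dots> = ennreal (lam ^ t * (fact t * Zhat p m k n S t))"
    using lam by (simp add: A_fin Z ennreal_mult)
  finally show ?thesis .
qed

lemma Zhat_nonneg: "0 \<le> Zhat p m k n S t"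
  by (simp add: Zhat_def)

lemma Zhat_0: "Zhat p m k n S 0 = 1"
  by (simp add: Zhat_def)

lemma Zhat_le: "Zhat p m k n S t \<le> V ^ t / fact t"
proof -
  have "ennreal (fact t * Zhat p m k n S t) \<le> (\<integral>\<^sup>+x. activity 1 x \<partial>lebn n) ^ t"
    using weight_activity[of 1 t] weight_le_power[of "activity 1" t] by simp
  also have "\<dots> = ennreal (V ^ t)"
    using V by (simp only: nn_integral_activity[OF zero_less_one]) (simp add: ennreal_power)
  finally have "fact t * Zhat p m k n S t \<le> V ^ t"
    using V by (simp add: ennreal_le_iff)
  then show ?thesis
    by (simp add: field_simps)
qed

lemma summable_Zhat: "0 < x \<Longrightarrow> summable (\<lambda>t. Zhat p m k n S t * x ^ t)"
proof (rule summable_comparison_test'[OF summable_exp[of "V * x"], of 0])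
  fix t assume "0 < x"
  then show "norm (Zhat p m k n S t * x ^ t) \<le> inverse (fact t) * (V * x) ^ t"
    using Zhat_le[of t] Zhat_nonneg[of t] mult_right_mono[OF Zhat_le[of t], of "x ^ t"]
    by (simp add: power_mult_distrib field_simps)
qed

lemma summable_Zhat_weighted:
  assumes x: "0 < x"
  shows "summable (\<lambda>t. real t * (Zhat p m k n S t * x ^ t))"
proof (rule summable_comparison_test'[OF summable_Zhat[of "2 * x"], of 0])
  fix t
  \<comment> \<open>The factor \<open>t\<close> is absorbed by doubling the argument, since the
    series of \<open>Zhat\<close> converges at every positive argument.\<close>
  have "real t \<le> 2 ^ t"
    using of_nat_less_two_power[of t] by (simp add: less_imp_le)
  then have "real t * (Zhat p m k n S t * x ^ t) \<le> 2 ^ t * (Zhat p m k n S t * x ^ t)"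
    using x Zhat_nonneg[of t] by (intro mult_right_mono) auto
  then show "norm (real t * (Zhat p m k n S t * x ^ t)) \<le> Zhat p m k n S t * (2 * x) ^ t"
    using x Zhat_nonneg[of t] by (simp add: power_mult_distrib mult_ac)
qed (use x in simp)

lemma alpha_eq:
  assumes lam: "0 < lam"
  shows "alpha p m k n S lam =
    (\<Sum>t. real t * (Zhat p m k n S t * lam ^ t)) / (\<Sum>t. Zhat p m k n S t * lam ^ t) / V"
proof -
  have "(\<Sum>t. real t * (lam ^ t * Zhat p m k n S t / Zpart p m k n S lam)) =
      (\<Sum>t. real t * (Zhat p m k n S t * lam ^ t) / Zpart p m k n S lam)"
    by (simp add: mult_ac)
  also have "\<dots> = (\<Sum>t. real t * (Zhat p m k n S t * lam ^ t)) / Zpart p m k n S lam"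
    by (intro suminf_divide summable_Zhat_weighted lam)
  finally show ?thesis
    using V by (simp add: alpha_def Zpart_def measure_def mult.commute)
qed

lemma Zpart_pos: "0 < lam \<Longrightarrow> 0 < (\<Sum>t. Zhat p m k n S t * lam ^ t)"
  using Zhat_nonneg Zhat_0 by (intro suminf_pos2[of _ 0] summable_Zhat) auto

lemma alpha_nonneg: "0 < lam \<Longrightarrow> 0 \<le> alpha p m k n S lam"
  using V Zhat_nonneg less_imp_le[OF Zpart_pos[of lam]]
  by (auto simp: alpha_eq intro!: divide_nonneg_nonneg suminf_nonneg summable_Zhat_weighted)

lemma alpha_mono:
  assumes "0 < lam" "lam \<le> mu"
  shows "alpha p m k n S lam \<le> alpha p m k n S mu"
  unfolding alpha_eq[OF assms(1)] alpha_eq[OF less_le_trans[OF assms]]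
  using assms V Zhat_0
  by (intro divide_right_mono power_series_mean_mono summable_Zhat summable_Zhat_weighted) (auto simp: Zhat_nonneg)

lemma partition_fun_activity:
  assumes lam: "0 < lam"
  shows "partition_fun (activity lam) = ennreal (\<Sum>t. Zhat p m k n S t * lam ^ t)"
proof -
  have "ennreal (1 / fact t) * weight t (activity lam) = ennreal (Zhat p m k n S t * lam ^ t)" for t
    using lam by (simp add: weight_activity ennreal_mult[symmetric] Zhat_nonneg)
  then show ?thesis
    unfolding partition_fun_def using lam summable_Zhat[OF lam]
    by (simp add: suminf_ennreal2 Zhat_nonneg)
qed

lemma moment_activity:
  assumes lam: "0 < lam"
  shows "moment (activity lam) = ennreal (\<Sum>t. real t * (Zhat p m k n S t * lam ^ t))"
proof -
  let ?f = "\<lambda>t. real t * (Zhat p m k n S t * lam ^ t)"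
  have f_nonneg: "0 \<le> ?f t" for t
    using lam by (simp add: Zhat_nonneg)
  have "ennreal (1 / fact t) * weight (Suc t) (activity lam) = ennreal (?f (Suc t))" for t
    using lam by (simp add: weight_activity ennreal_mult[symmetric] Zhat_nonneg field_simps)
  then have "moment (activity lam) = (\<Sum>t. ennreal (?f (Suc t)))"
    by (subst moment_eq) auto
  also have "\<dots> = ennreal (\<Sum>t. ?f (Suc t))"
    by (intro suminf_ennreal2 f_nonneg) (simp only: summable_Suc_iff[of ?f] summable_Zhat_weighted[OF lam])
  also have "(\<Sum>t. ?f (Suc t)) = (\<Sum>t. ?f t)"
    using suminf_split_head[OF summable_Zhat_weighted[OF lam]] by simp
  finally show ?thesis .
qed

text \<open>This is \<open>moment_lower_bound\<close> with excluded activity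
  \<open>lam * 2 ^ n\<close> and overlap \<open>2 * lam * (2 * lens_ratio p) ^ n\<close>, divided by
  the partition function and the volume of \<open>S\<close>; both parameters are independent of
  \<open>S\<close>.\<close>

lemma alpha_lower_bound:
  assumes lam: "0 < lam"
  shows "exp (- z) * (1 + z) * lam \<le>
    alpha p m k n S lam * (1 + exp (2 * lam * (2 * lens_ratio p) ^ n - z) * (lam * 2 ^ n))"
proof (cases "1 + z \<le> 0")
  case True
  then have "exp (- z) * (1 + z) * lam \<le> 0"
    using lam by (simp add: mult_nonneg_nonpos mult_nonpos_nonneg)
  also have "0 \<le> alpha p m k n S lam * (1 + exp (2 * lam * (2 * lens_ratio p) ^ n - z) * (lam * 2 ^ n))"
    using lam by (intro mult_nonneg_nonneg alpha_nonneg add_nonneg_nonneg) auto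
  finally show ?thesis .
next
  case False
  define \<kappa> where "\<kappa> = 2 * lam * (2 * lens_ratio p) ^ n"
  have c: "0 \<le> (2 * lens_ratio p) ^ n"
    using lens_ratio_bounds[OF p] by simp
  then have \<kappa>: "0 \<le> \<kappa>"
    using lam by (simp add: \<kappa>_def)
  define A Z where "A = (\<Sum>t. real t * (Zhat p m k n S t * lam ^ t))" and "Z = (\<Sum>t. Zhat p m k n S t * lam ^ t)"
  have Z: "0 < Z"
    unfolding Z_def by (rule Zpart_pos[OF lam])
  have A: "0 \<le> A"
    unfolding A_def using lam by (intro suminf_nonneg summable_Zhat_weighted) (auto simp: Zhat_nonneg)
  have "ennreal (exp (- z) * (1 + z)) * (partition_fun (activity lam) * (\<integral>\<^sup>+x. activity lam x \<partial>lebn n)) \<le>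
      moment (activity lam) + ennreal (exp (\<kappa> - z)) * (ennreal (lam * 2 ^ n) * moment (activity lam))"
  proof (rule moment_lower_bound)
    show "(\<integral>\<^sup>+x. activity lam x \<partial>lebn n) < top"
      by (simp only: nn_integral_activity[OF lam]) simp
  next
    fix x assume "x \<in> space (lebn n)"
    then have "(\<integral>\<^sup>+v. activity lam v * (1 - e v x) \<partial>lebn n) \<le> 2 ^ n * ennreal lam"
      by (intro excluded_volume) (auto split: split_indicator)
    then show "(\<integral>\<^sup>+v. activity lam v * (1 - e v x) \<partial>lebn n) \<le> ennreal (lam * 2 ^ n)"
      using lam by (simp add: ennreal_mult mult.commute flip: ennreal_power)
  next
    fix w \<tau> assume w: "w \<in> space (lebn n)" and \<tau>: "\<tau> \<in> borel_measurable (lebn n)"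
      and le: "\<And>x. \<tau> x \<le> activity lam x * (1 - e w x)"
    have "\<tau> x \<le> ennreal lam * (1 - e w x)" for x
      using le[of x] by (auto split: split_indicator_asm)
    from local_overlap[OF \<tau> w this]
    show "(\<integral>\<^sup>+x. \<tau> x * (\<integral>\<^sup>+y. \<tau> y * (1 - e x y) \<partial>lebn n) \<partial>lebn n) \<le> ennreal \<kappa> * (\<integral>\<^sup>+x. \<tau> x \<partial>lebn n)"
      using lam c by (simp add: \<kappa>_def ennreal_mult mult.assoc)
  qed (use \<kappa> in auto)
  then have "ennreal (exp (- z) * (1 + z) * (Z * (lam * V))) \<le> ennreal (A + exp (\<kappa> - z) * (lam * 2 ^ n * A))"
    using False lam Z A V
    by (simp add: partition_fun_activity[OF lam] moment_activity[OF lam] nn_integral_activity[OF lam]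
        Z_def[symmetric] A_def[symmetric] ennreal_mult'[symmetric] ennreal_plus[symmetric] del: ennreal_plus)
  then have "exp (- z) * (1 + z) * (Z * (lam * V)) \<le> A + exp (\<kappa> - z) * (lam * 2 ^ n * A)"
    using lam A by (subst (asm) ennreal_le_iff) auto
  then have "exp (- z) * (1 + z) * lam * (Z * V) \<le> (A / Z / V * (1 + exp (\<kappa> - z) * (lam * 2 ^ n))) * (Z * V)"
    using Z V by (simp add: algebra_simps)
  then have "exp (- z) * (1 + z) * lam \<le> A / Z / V * (1 + exp (\<kappa> - z) * (lam * 2 ^ n))"
    using Z V by (subst (asm) mult_le_cancel_right_pos) auto
  then show ?thesis
    by (simp add: alpha_eq[OF lam] A_def Z_def \<kappa>_def)
qed

end

end

section \<open>Choice of parameters and asymptotics\<close>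

lemma density_constant_tendsto:
  fixes L :: real
  assumes "0 < L"
  shows "(\<lambda>n. (1 + (real n * L - 2 * ln n)) / (real n * L * (1 / n + exp (2 / n))) - 1) \<longlonglongrightarrow> 0"
  using assms by real_asymp

theorem theorem8:
  fixes p :: real
  assumes "1 < p" and "p \<le> 2"
  shows "\<exists>c::real. \<exists>\<eta>::nat \<Rightarrow> real. 0 < c \<and> c < 2 \<and> \<eta> \<longlonglongrightarrow> 0 \<and>
    (\<forall>n m k S lam. valid_blocks n m k \<longrightarrow>
       S \<in> sets (lebn n) \<longrightarrow> S \<subseteq> PiE {..<n} (\<lambda>_. UNIV) \<longrightarrow>
       (\<exists>B. \<forall>x\<in>S. \<forall>i<n. \<bar>x i\<bar> \<le> B) \<longrightarrow>
       emeasure (lebn n) S > 0 \<longrightarrow>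
       lam \<ge> 1 / (real n * c ^ n) \<longrightarrow>
       alpha p m k n S lam \<ge> (1 + \<eta> n) * (ln (2 / c) * real n / 2 ^ n))"
proof -
  define c where "c = 2 * lens_ratio p"
  define L where "L = ln (2 / c)"
  define \<eta> where "\<eta> n = (1 + (real n * L - 2 * ln n)) / (real n * L * (1 / n + exp (2 / n))) - 1" for n :: nat
  have c: "0 < c" "c < 2"
    using lens_ratio_bounds[OF assms] by (auto simp: c_def)
  then have L: "0 < L"
    by (simp add: L_def)
  have bound: "(1 + \<eta> n) * (ln (2 / c) * real n / 2 ^ n) \<le> alpha p m k n S lam"
    if v: "valid_blocks n m k" and S: "S \<in> sets (lebn n)" and bdd: "\<exists>B. \<forall>x\<in>S. \<forall>i<n. \<bar>x i\<bar> \<le> B"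
      and S_pos: "emeasure (lebn n) S > 0" and lam: "1 / (real n * c ^ n) \<le> lam" for n m k S lam
  proof -
    interpret superballs p n m k
      by standard (use assms v in auto)
    have n: "0 < n"
      using v valid_blocks_le[OF v] by (simp add: valid_blocks_def)
    have "emeasure (lebn n) S < top"
      using emeasure_lebn_bounded[OF S] bdd by blast
    then obtain V where V: "emeasure (lebn n) S = ennreal V" "0 < V"
      using S_pos by (cases "emeasure (lebn n) S") auto
    \<comment> \<open>It suffices to treat the smallest admissible fugacity. The term
      \<open>2 * ln n\<close> is chosen so that \<open>exp z\<close> is smaller than
      \<open>lam0 * 2 ^ n\<close> by the factor \<open>n\<close>: the first summand of the bound
      becomes negligible at a cost of lower order than \<open>n\<close>.\<close>
    define lam0 z where "lam0 = 1 / (real n * c ^ n)" and "z = real n * L - 2 * ln n"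
    have lam0: "0 < lam0"
      using n c by (simp add: lam0_def)
    have c_pow: "2 * lam0 * c ^ n = 2 / n"
      using n c by (simp add: lam0_def)
    have "exp z = exp L ^ n / exp (ln n) ^ 2"
      by (simp add: z_def exp_diff exp_of_nat_mult[symmetric] exp_double[symmetric])
    also have "exp L = 2 / c"
      using c by (simp add: L_def)
    finally have exp_z: "exp z = lam0 * 2 ^ n / n"
      using n c by (simp add: lam0_def power_divide field_simps power2_eq_square)
    have "exp (- z) * (1 + z) * lam0 \<le> alpha p m k n S lam0 * (1 + exp (2 * lam0 * c ^ n - z) * (lam0 * 2 ^ n))"
      using alpha_lower_bound[OF S V lam0, of z] by (simp add: c_def)
    then have "exp z * (exp (- z) * (1 + z) * lam0) \<le>
        exp z * (alpha p m k n S lam0 * (1 + exp (2 * lam0 * c ^ n - z) * (lam0 * 2 ^ n)))"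
      by (intro mult_left_mono) auto
    also have "exp z * (exp (- z) * (1 + z) * lam0) = (1 + z) * lam0"
      by (simp add: exp_minus)
    also have "exp z * (alpha p m k n S lam0 * (1 + exp (2 * lam0 * c ^ n - z) * (lam0 * 2 ^ n))) =
        alpha p m k n S lam0 * (exp z + exp (2 / n) * (lam0 * 2 ^ n))"
      unfolding c_pow exp_diff by (simp add: field_simps)
    also have "\<dots> = alpha p m k n S lam0 * ((1 / n + exp (2 / n)) * 2 ^ n) * lam0"
      by (simp add: exp_z algebra_simps)
    finally have "1 + z \<le> alpha p m k n S lam0 * ((1 / n + exp (2 / n)) * 2 ^ n)"
      using lam0 by simp
    then have "(1 + z) / ((1 / n + exp (2 / n)) * 2 ^ n) \<le> alpha p m k n S lam0"
      using n by (subst pos_divide_le_eq) (auto intro!: mult_pos_pos add_pos_pos)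
    \<comment> \<open>By its definition \<open>\<eta> n\<close> is the relative deviation of this
      bound from \<open>n * L / 2 ^ n\<close>.\<close>
    also have "(1 + z) / ((1 / n + exp (2 / n)) * 2 ^ n) = (1 + \<eta> n) * (ln (2 / c) * real n / 2 ^ n)"
      using n L by (simp add: \<eta>_def z_def L_def[symmetric])
    also have "alpha p m k n S lam0 \<le> alpha p m k n S lam"
      using lam by (intro alpha_mono[OF S V] lam0) (simp add: lam0_def)
    finally show ?thesis .
  qed
  show ?thesis
    using c density_constant_tendsto[OF L] bound
    by (intro exI[of _ c] exI[of _ \<eta>]) (auto simp: \<eta>_def[abs_def])
qed

end
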